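(* Let $\Omega\subset\mathbb R^n$ be open, $t_1<t_2$, and let $f\ge0$ be continuous on $\Omega\times(t_1,t_2)$. Let $\psi:(0,\infty)\to(0,\infty)$ satisfy $\lim_{\varepsilon\to0}\psi(\varepsilon)=\infty$ and $\lim_{\varepsilon\to0}\varepsilon\,\psi(\varepsilon)=0$. A parabolically convex function $u\in C(\Omega\times(t_1,t_2))$ is a viscosity solution of $$-\frac{\partial u}{\partial t}(x,t)\cdot\det D^2u(x,t)=f(x,t)\quad\text{in }\Omega\times(t_1,t_2)$$ if and only if $$u(x,t)=\inf_{\substack{b\det A=1\\ A\le\psi(\varepsilon)I,\ b\le\psi(\varepsilon)}}\left\{\frac{1}{\frac{b^2}{n+2}\varepsilon^2}\int_{t-\frac{b^2}{n+2}\varepsilon^2}^{t}\frac{1}{|B_\varepsilon(0)|}\int_{B_\varepsilon(0)}u(x+Ay,s)\,dy\,ds\right\}-\frac{n+1}{2(n+2)}\big(f(x,t)\big)^{\frac1{n+1}}\varepsilon^2+o(\varepsilon^2)\quad\text{as }\varepsilon\to0,$$ for $x\in\Omega$, $t\in(t_1,t_2)$, in the viscosity sense.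
   Context: A function is parabolically convex if it is continuous, convex in the spatial variable $x$, and non-increasing in $t$. The infimum is over pairs $(A,b)$ with $A$ a symmetric positive definite $n\times n$ matrix and $b>0$ a real number; $A\le\theta I$ means $\theta I-A$ is positive semidefinite. $C^{2,1}$ denotes functions twice continuously differentiable in $x$ and continuously differentiable in $t$. For a constant $c$ and function $g$, "$c\le g(\varepsilon)+o(\varepsilon^2)$" means $\lim_{\varepsilon\to0}[c-g(\varepsilon)]^+/\varepsilon^2=0$ and "$c\ge g(\varepsilon)+o(\varepsilon^2)$" means $\lim_{\varepsilon\to0}[c-g(\varepsilon)]^-/\varepsilon^2=0$. Viscosity solution: a parabolically convex $u$ is a viscosity solution of $-\partial_tu\det D^2u=f$ if for every $(x,t)\in\Omega\times(t_1,t_2)$ and every parabolically convex $\phi\in C^{2,1}$: (i) if $u-\phi$ has a strict local maximum at $(x,t)$ with $u(x,t)=\phi(x,t)$, then $-\partial_t\phi(x,t)\det D^2\phi(x,t)\ge f(x,t)$; (ii) if $u-\phi$ has a strict local minimum at $(x,t)$ with $u(x,t)=\phi(x,t)$, then $-\partial_t\phi(x,t)\det D^2\phi(x,t)\le f(x,t)$. Asymptotic formula in the viscosity sense: writing the formula as $u(x,t)=M_\varepsilon[u](x,t)+o(\varepsilon^2)$ where $M_\varepsilon[v](x,t)$ denotes the right-hand side expression (infimum of averages plus the $f$ term), it holds in the viscosity sense if for every $(x,t)$ and every parabolically convex $\phi\in C^{2,1}$: (i) if $u-\phi$ has a strict local minimum at $(x,t)$ with $u(x,t)=\phi(x,t)$,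 then $0\ge-\phi(x,t)+M_\varepsilon[\phi](x,t)+o(\varepsilon^2)$; (ii) if $u-\phi$ has a strict local maximum at $(x,t)$ with $u(x,t)=\phi(x,t)$, then $0\le-\phi(x,t)+M_\varepsilon[\phi](x,t)+o(\varepsilon^2)$. *)

theory Defs
  imports "HOL-Analysis.Analysis"
begin

definition tint :: "real \<Rightarrow> real \<Rightarrow> real set" where
  "tint t1 t2 = {t1<..<t2}"

definition parab_convex ::
  "(real^'n) set \<Rightarrow> real \<Rightarrow> real \<Rightarrow> (real^'n \<Rightarrow> real \<Rightarrow> real) \<Rightarrow> bool" where
  "parab_convex \<Omega> t1 t2 u \<longleftrightarrow>
     continuous_on (\<Omega> \<times> tint t1 t2) (\<lambda>(x,t). u x t) \<and>
     (\<forall>t\<in>tint t1 t2. \<forall>x y. closed_segment x y \<subseteq> \<Omega> \<longrightarrow>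
          convex_on (closed_segment x y) (\<lambda>z. u z t)) \<and>
     (\<forall>x\<in>\<Omega>. \<forall>s t. t1 < s \<and> s \<le> t \<and> t < t2 \<longrightarrow> u x t \<le> u x s)"

definition dt :: "(real^'n \<Rightarrow> real \<Rightarrow> real) \<Rightarrow> real^'n \<Rightarrow> real \<Rightarrow> real" where
  "dt \<phi> x t = deriv (\<lambda>s. \<phi> x s) t"

definition grad :: "(real^'n \<Rightarrow> real \<Rightarrow> real) \<Rightarrow> real \<Rightarrow> real^'n \<Rightarrow> real^'n" where
  "grad \<phi> t x = (\<chi> i. frechet_derivative (\<lambda>y. \<phi> y t) (at x) (axis i 1))"

definition hess :: "(real^'n \<Rightarrow> real \<Rightarrow> real) \<Rightarrow> real^'n \<Rightarrow> real \<Rightarrow> real^'n^'n" where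
  "hess \<phi> x t = (\<chi> i j. frechet_derivative (\<lambda>y. grad \<phi> t y $ i) (at x) (axis j 1))"

definition C21 ::
  "(real^'n) set \<Rightarrow> real \<Rightarrow> real \<Rightarrow> (real^'n \<Rightarrow> real \<Rightarrow> real) \<Rightarrow> bool" where
  "C21 \<Omega> t1 t2 \<phi> \<longleftrightarrow>
     (\<forall>x\<in>\<Omega>. \<forall>t\<in>tint t1 t2.
        (\<lambda>s. \<phi> x s) differentiable (at t) \<and>
        (\<lambda>y. \<phi> y t) differentiable (at x) \<and>
        (\<lambda>y. grad \<phi> t y) differentiable (at x)) \<and>
     continuous_on (\<Omega> \<times> tint t1 t2) (\<lambda>(x,t). \<phi> x t) \<and>
     continuous_on (\<Omega> \<times> tint t1 t2) (\<lambda>(x,t). dt \<phi> x t) \<and>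
     continuous_on (\<Omega> \<times> tint t1 t2) (\<lambda>(x,t). grad \<phi> t x) \<and>
     continuous_on (\<Omega> \<times> tint t1 t2) (\<lambda>(x,t). hess \<phi> x t)"

definition strict_loc_max :: "('a::metric_space) set \<Rightarrow> ('a \<Rightarrow> real) \<Rightarrow> 'a \<Rightarrow> bool" where
  "strict_loc_max D g p \<longleftrightarrow> (\<exists>r>0. ball p r \<subseteq> D \<and> (\<forall>q\<in>ball p r. q \<noteq> p \<longrightarrow> g q < g p))"

definition strict_loc_min :: "('a::metric_space) set \<Rightarrow> ('a \<Rightarrow> real) \<Rightarrow> 'a \<Rightarrow> bool" where
  "strict_loc_min D g p \<longleftrightarrow> (\<exists>r>0. ball p r \<subseteq> D \<and> (\<forall>q\<in>ball p r. q \<noteq> p \<longrightarrow> g q > g p))"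

definition visc_sol ::
  "(real^'n) set \<Rightarrow> real \<Rightarrow> real \<Rightarrow> (real^'n \<Rightarrow> real \<Rightarrow> real) \<Rightarrow> (real^'n \<Rightarrow> real \<Rightarrow> real) \<Rightarrow> bool" where
  "visc_sol \<Omega> t1 t2 f u \<longleftrightarrow> parab_convex \<Omega> t1 t2 u \<and>
     (\<forall>x\<in>\<Omega>. \<forall>t\<in>tint t1 t2. \<forall>\<phi>. parab_convex \<Omega> t1 t2 \<phi> \<and> C21 \<Omega> t1 t2 \<phi> \<longrightarrow>
        ((strict_loc_max (\<Omega> \<times> tint t1 t2) (\<lambda>(y,s). u y s - \<phi> y s) (x,t) \<and> u x t = \<phi> x t
            \<longrightarrow> - dt \<phi> x t * det (hess \<phi> x t) \<ge> f x t) \<and>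
         (strict_loc_min (\<Omega> \<times> tint t1 t2) (\<lambda>(y,s). u y s - \<phi> y s) (x,t) \<and> u x t = \<phi> x t
            \<longrightarrow> - dt \<phi> x t * det (hess \<phi> x t) \<le> f x t)))"

definition admissible :: "real \<Rightarrow> real^'n^'n \<Rightarrow> real \<Rightarrow> bool" where
  "admissible M A b \<longleftrightarrow> transpose A = A \<and> (\<forall>v. v \<noteq> 0 \<longrightarrow> v \<bullet> (A *v v) > 0) \<and> b > 0 \<and>
     b * det A = 1 \<and> (\<forall>v. v \<bullet> ((M *\<^sub>R mat 1 - A) *v v) \<ge> 0) \<and> b \<le> M"

definition cyl_avg ::
  "(real^'n \<Rightarrow> real \<Rightarrow> real) \<Rightarrow> real^'n \<Rightarrow> real \<Rightarrow> real^'n^'n \<Rightarrow> real \<Rightarrow> real \<Rightarrow> real" where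
  "cyl_avg v x t A b \<epsilon> =
     (let h = b\<^sup>2 / (real CARD('n) + 2) * \<epsilon>\<^sup>2 in
      (1 / h) * integral {t - h..t}
        (\<lambda>s. (1 / measure lborel (ball (0::real^'n) \<epsilon>)) *
              integral (ball (0::real^'n) \<epsilon>) (\<lambda>y. v (x + A *v y) s)))"

definition Meps ::
  "(real \<Rightarrow> real) \<Rightarrow> (real^'n \<Rightarrow> real \<Rightarrow> real) \<Rightarrow> real \<Rightarrow> (real^'n \<Rightarrow> real \<Rightarrow> real)
     \<Rightarrow> real^'n \<Rightarrow> real \<Rightarrow> real" where
  "Meps \<psi> f \<epsilon> v x t =
     Inf {cyl_avg v x t A b \<epsilon> | (A::real^'n^'n) b. admissible (\<psi> \<epsilon>) A b}
     - (real CARD('n) + 1) / (2 * (real CARD('n) + 2)) * (f x t) powr (1 / (real CARD('n) + 1)) * \<epsilon>\<^sup>2"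

text \<open>The asymptotic mean value formula u = M_eps[u] + o(eps^2) in the viscosity sense.
  "0 >= g(eps) + o(eps^2)" means [0 - g]^- / eps^2 -> 0, i.e. max g 0 / eps^2 -> 0;
  "0 <= g(eps) + o(eps^2)" means [0 - g]^+ / eps^2 -> 0, i.e. max (-g) 0 / eps^2 -> 0.\<close>
definition amvp_visc ::
  "(real^'n) set \<Rightarrow> real \<Rightarrow> real \<Rightarrow> (real \<Rightarrow> real) \<Rightarrow> (real^'n \<Rightarrow> real \<Rightarrow> real)
     \<Rightarrow> (real^'n \<Rightarrow> real \<Rightarrow> real) \<Rightarrow> bool" where
  "amvp_visc \<Omega> t1 t2 \<psi> f u \<longleftrightarrow>
     (\<forall>x\<in>\<Omega>. \<forall>t\<in>tint t1 t2. \<forall>\<phi>. parab_convex \<Omega> t1 t2 \<phi> \<and> C21 \<Omega> t1 t2 \<phi> \<longrightarrow>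
        ((strict_loc_min (\<Omega> \<times> tint t1 t2) (\<lambda>(y,s). u y s - \<phi> y s) (x,t) \<and> u x t = \<phi> x t
            \<longrightarrow> ((\<lambda>\<epsilon>. max (Meps \<psi> f \<epsilon> \<phi> x t - \<phi> x t) 0 / \<epsilon>\<^sup>2) \<longlongrightarrow> 0) (at_right 0)) \<and>
         (strict_loc_max (\<Omega> \<times> tint t1 t2) (\<lambda>(y,s). u y s - \<phi> y s) (x,t) \<and> u x t = \<phi> x t
            \<longrightarrow> ((\<lambda>\<epsilon>. max (\<phi> x t - Meps \<psi> f \<epsilon> \<phi> x t) 0 / \<epsilon>\<^sup>2) \<longlongrightarrow> 0) (at_right 0))))"

end

theory Submission
  imports Defs
begin

text \<open>
  For a test function \<open>\<phi>\<close> put \<open>H = D\<^sup>2\<phi>(x,t)\<close> and \<open>p = - \<partial>\<^sub>t\<phi>(x,t)\<close>. By Taylor expansion and the second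
  moments of the ball, the average of \<open>\<phi>\<close> over the cylinder given by \<open>(A, b)\<close> is
  \<open>\<phi>(x,t) + \<epsilon>\<^sup>2/(2(n+2)) (tr(A H A) + p b\<^sup>2)\<close> up to an error \<open>\<eta> \<epsilon>\<^sup>2 (tr(A A) + b\<^sup>2)\<close>, where \<open>\<eta>\<close> is
  arbitrarily small as soon as \<open>\<epsilon> \<psi>(\<epsilon>)\<close> is. Under \<open>b det A = 1\<close> the arithmetic-geometric mean
  inequality gives \<open>inf (tr(A H A) + p b\<^sup>2) = (n+1) (p det H)\<^bsup>1/(n+1)\<^esup>\<close>.
  The error is not \<open>o(\<epsilon>\<^sup>2)\<close> uniformly in \<open>A\<close>; it is absorbed by lowering \<open>H\<close> and \<open>p\<close> slightly when
  \<open>p det H > 0\<close>, while for \<open>p det H = 0\<close> convexity and monotonicity show that every average is at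
  least \<open>\<phi>(x,t)\<close>. Hence \<open>(M\<^sub>\<epsilon>[\<phi>] - \<phi>)/\<epsilon>\<^sup>2\<close> converges to a positive multiple of
  \<open>(p det H)\<^bsup>1/(n+1)\<^esup> - f\<^bsup>1/(n+1)\<^esup>\<close>, and the two viscosity notions agree test function by test function.
\<close>

section \<open>Symmetric matrices\<close>

text \<open>Maximise the Rayleigh quotient over the unit vectors orthogonal to \<open>B\<close>.
  Since \<open>B\<close> consists of eigenvectors and \<open>f\<close> is symmetric,
  \<open>f\<close> maps the orthogonal complement \<open>S\<close> of \<open>B\<close> into itself,
  so the residual \<open>f v - c *\<^sub>R v\<close> at the maximiser \<open>v\<close> is an allowed
  direction of variation and must vanish.\<close>

lemma symmetric_linear_eigenvector_orthogonal_to: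
  fixes f :: "'a::euclidean_space \<Rightarrow> 'a"
  assumes "linear f" and sym: "\<And>x y. f x \<bullet> y = x \<bullet> f y"
    and eig: "\<And>y. y \<in> B \<Longrightarrow> \<exists>c. f y = c *\<^sub>R y" and dim: "dim B < DIM('a)"
  obtains v c where "norm v = 1" "f v = c *\<^sub>R v" "\<And>y. y \<in> B \<Longrightarrow> y \<bullet> v = 0"
proof -
  interpret linear f by fact
  define S where "S = {x. \<forall>y\<in>B. y \<bullet> x = 0}"
  have S: "subspace S"
    by (auto simp: S_def subspace_def inner_right_distrib)
  have inv: "f x \<in> S" if "x \<in> S" for x
    unfolding S_def
  proof (intro CollectI ballI)
    fix y assume y: "y \<in> B"
    obtain c where "f y = c *\<^sub>R y" using eig[OF y] by blast
    then show "y \<bullet> f x = 0" using that y by (simp add: S_def flip: sym)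
  qed
  \<comment> \<open>This is where \<open>dim B < DIM('a)\<close> enters: it makes the unit sphere of
    \<open>S\<close> nonempty, so that a maximiser exists.\<close>
  obtain x0 where x0: "x0 \<noteq> 0" "\<And>y. y \<in> span B \<Longrightarrow> orthogonal x0 y"
    using orthogonal_to_subspace_exists[OF dim] by blast
  have x0S: "x0 \<in> S"
    using x0(2) by (auto simp: S_def orthogonal_def inner_commute span_base)
  define K where "K = sphere 0 1 \<inter> S"
  have "compact K"
    unfolding K_def using closed_subspace[OF S] by (simp add: compact_Int_closed)
  moreover have "x0 /\<^sub>R norm x0 \<in> K"
    using x0 x0S S by (simp add: K_def subspace_scale)
  moreover have "continuous_on K (\<lambda>x. x \<bullet> f x)"
    by (intro continuous_intros linear_continuous_on) (simp add: \<open>linear f\<close> linear_linear)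
  ultimately obtain v where v: "v \<in> K" and vmax: "\<And>x. x \<in> K \<Longrightarrow> x \<bullet> f x \<le> v \<bullet> f v"
    using continuous_attains_sup[of K "\<lambda>x. x \<bullet> f x"] by blast
  define c where "c = v \<bullet> f v"
  have vS: "v \<in> S" and nv: "norm v = 1" using v by (auto simp: K_def)
  have le: "x \<bullet> f x \<le> c * (x \<bullet> x)" if "x \<in> S" for x
  proof (cases "x = 0")
    case False
    then have "x /\<^sub>R norm x \<in> K" using that S by (simp add: K_def subspace_scale)
    from vmax[OF this] have "(x \<bullet> f x) / (norm x * norm x) \<le> c"
      by (simp add: c_def scale divide_simps mult.assoc)
    then show ?thesis using False
      by (simp add: divide_le_eq dot_square_norm power2_eq_square split: if_splits)
  qed (simp add: zero)
  define w where "w = f v - c *\<^sub>R v"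
  have wS: "w \<in> S"
    unfolding w_def using inv[OF vS] vS S by (simp add: subspace_diff subspace_scale)
  \<comment> \<open>First variation of the Rayleigh quotient at its maximiser, in the direction w.\<close>
  define k where "k = c * (w \<bullet> w) - w \<bullet> f w"
  have quad: "2 * s * (w \<bullet> w) \<le> s\<^sup>2 * k" for s
  proof -
    have "v + s *\<^sub>R w \<in> S" using vS wS S by (simp add: subspace_add subspace_scale)
    from le[OF this]
    have "c + 2 * s * (w \<bullet> f v) + s\<^sup>2 * (w \<bullet> f w)
         \<le> c * (1 + 2 * s * (w \<bullet> v) + s\<^sup>2 * (w \<bullet> w))"
      using nv sym[of v w] norm_eq_1[of v]
      by (simp add: add scale inner_simps c_def power2_eq_square inner_commute algebra_simps)
    moreover have "s * (w \<bullet> w) = s * (w \<bullet> f v) - s * c * (w \<bullet> v)"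
      by (subst (2) w_def) (simp add: inner_simps algebra_simps)
    ultimately show ?thesis unfolding k_def by argo
  qed
  have "w \<bullet> w = 0"
  proof (rule ccontr)
    assume "w \<bullet> w \<noteq> 0"
    then have pos: "w \<bullet> w > 0" by simp
    \<comment> \<open>This \<open>s\<close> satisfies \<open>s * k \<le> w \<bullet> w\<close>,
      whereas the variation inequality demands
      \<open>s * k \<ge> 2 * (w \<bullet> w)\<close>.\<close>
    define s where "s = (w \<bullet> w) / (1 + \<bar>k\<bar>)"
    have spos: "s > 0" using pos by (simp add: s_def)
    have "2 * (w \<bullet> w) \<le> s * k"
      using quad[of s] spos by (simp add: power2_eq_square)
    also have "\<dots> \<le> s * (1 + \<bar>k\<bar>)" using spos by simp
    also have "\<dots> = w \<bullet> w" by (simp add: s_def add_nonneg_eq_0_iff)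
    finally show False using pos by simp
  qed
  then have "f v = c *\<^sub>R v" by (simp add: w_def)
  then show thesis using that nv vS by (auto simp: S_def)
qed

text \<open>Induction on \<open>k\<close>: fewer than \<open>DIM('a)\<close> vectors do not span, so
  there is room for one more unit eigenvector orthogonal to those already found. For
  \<open>k = DIM('a)\<close> the result is an orthonormal eigenbasis.\<close>

lemma symmetric_linear_orthonormal_eigenvectors:
  fixes f :: "'a::euclidean_space \<Rightarrow> 'a"
  assumes "linear f" and sym: "\<And>x y. f x \<bullet> y = x \<bullet> f y" and "k \<le> DIM('a)"
  shows "\<exists>B. finite B \<and> card B = k \<and> pairwise orthogonal B
           \<and> (\<forall>x\<in>B. norm x = 1 \<and> (\<exists>c. f x = c *\<^sub>R x))"
  using assms(3)
proof (induction k)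
  case 0
  show ?case by (intro exI[of _ "{}"]) auto
next
  case (Suc k)
  then obtain B where B: "finite B" "card B = k" "pairwise orthogonal B"
    "\<And>x. x \<in> B \<Longrightarrow> norm x = 1" "\<And>x. x \<in> B \<Longrightarrow> \<exists>c. f x = c *\<^sub>R x"
    by auto
  have "dim B < DIM('a)"
    using dim_le_card[OF span_superset B(1)] B(2) Suc.prems by simp
  then obtain v c where v: "norm v = 1" "f v = c *\<^sub>R v" "\<And>y. y \<in> B \<Longrightarrow> y \<bullet> v = 0"
    using symmetric_linear_eigenvector_orthogonal_to[OF assms(1) sym B(5)] by blast
  have "v \<notin> B" using v by force
  then show ?case
    using B v
    by (intro exI[of _ "insert v B"])
       (auto simp: pairwise_insert orthogonal_def[of v] orthogonal_def[of _ v] inner_commute[of v])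
qed

definition diag_mat :: "('n \<Rightarrow> real) \<Rightarrow> real^'n^'n" where
  "diag_mat d = (\<chi> i j. if i = j then d i else 0)"

lemma transpose_diag_mat [simp]: "transpose (diag_mat d) = diag_mat d"
  by (auto simp: diag_mat_def transpose_def vec_eq_iff)

lemma det_diag_mat: "det (diag_mat d :: real^'n^'n) = prod d UNIV"
  by (subst det_diagonal) (auto simp: diag_mat_def)

lemma trace_diag_mat: "trace (diag_mat d :: real^'n^'n) = sum d UNIV"
  by (simp add: trace_def diag_mat_def)

lemma sum_diag_mat_row: "(\<Sum>k\<in>UNIV. diag_mat d $ i $ k * g k) = d i * g i"
proof -
  have "diag_mat d $ i $ k * g k = (if k = i then d i * g i else 0)" for k
    by (simp add: diag_mat_def)
  then show ?thesis by simp
qed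

lemma diag_mat_mult: "diag_mat d ** diag_mat e = diag_mat (\<lambda>i. d i * e i)"
  by (simp add: matrix_matrix_mult_def vec_eq_iff sum_diag_mat_row) (simp add: diag_mat_def)

lemma diag_mat_vec: "(diag_mat d *v x) $ i = d i * x $ i"
  by (simp add: matrix_vector_mult_def sum_diag_mat_row)

lemma symmetric_matrix_inner:
  fixes A :: "real^'n^'n"
  assumes "transpose A = A"
  shows "(A *v x) \<bullet> y = x \<bullet> (A *v y)"
  by (metis assms dot_lmul_matrix transpose_matrix_vector)

text \<open>The columns of \<open>Q\<close> are an orthonormal basis of eigenvectors, enumerated by
  the index type; the eigenvector equations, read columnwise, say
  \<open>H ** Q = Q ** diag_mat d\<close>.\<close>

theorem symmetric_matrix_diagonalization:
  fixes H :: "real^'n^'n"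
  assumes H: "transpose H = H"
  obtains Q d where "orthogonal_matrix Q" "H = Q ** diag_mat d ** transpose Q"
proof -
  obtain B where B: "finite B" "card B = CARD('n)" "pairwise orthogonal B"
    and B1: "\<And>x. x \<in> B \<Longrightarrow> norm x = 1" and Be: "\<And>x. x \<in> B \<Longrightarrow> \<exists>c. H *v x = c *\<^sub>R x"
    using symmetric_linear_orthonormal_eigenvectors[of "(*v) H" "CARD('n)"]
    by (auto simp: symmetric_matrix_inner[OF H])
  obtain e where e: "bij_betw e (UNIV::'n set) B"
    using B finite_same_card_bij[of "UNIV::'n set" B] by auto
  have eB: "e i \<in> B" for i using e by (auto simp: bij_betw_def)
  define d where "d i = (SOME c. H *v e i = c *\<^sub>R e i)" for i
  have d: "H *v e i = d i *\<^sub>R e i" for i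
    unfolding d_def by (rule someI_ex[OF Be[OF eB]])
  define Q :: "real^'n^'n" where "Q = (\<chi> i j. e j $ i)"
  have Q: "orthogonal_matrix Q"
  proof -
    have "orthogonal (e i) (e j)" if "i \<noteq> j" for i j
      using pairwiseD[OF B(3) eB eB] e that by (metis UNIV_I bij_betw_def inj_on_def)
    then show ?thesis
      using B1[OF eB] by (simp add: Q_def orthogonal_matrix_orthonormal_columns column_def)
  qed
  have "H ** Q = Q ** diag_mat d"
  proof -
    have "(H ** Q) $ i $ j = (Q ** diag_mat d) $ i $ j" for i j
      using arg_cong[OF d[of j], of "\<lambda>x. x $ i"]
      by (simp add: Q_def diag_mat_def matrix_matrix_mult_def matrix_vector_mult_def
          if_distrib cong: if_cong)
    then show ?thesis by (simp add: vec_eq_iff)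
  qed
  then have "Q ** diag_mat d ** transpose Q = H ** (Q ** transpose Q)"
    by (metis matrix_mul_assoc)
  then have "H = Q ** diag_mat d ** transpose Q"
    using Q by (simp add: orthogonal_matrix_def)
  then show thesis using that Q by blast
qed

section \<open>Determinant, trace and quadratic form in an orthonormal eigenbasis\<close>

lemma det_conj_orthogonal:
  fixes M Q :: "real^'n^'n"
  assumes "orthogonal_matrix Q"
  shows "det (Q ** M ** transpose Q) = det M"
  using det_orthogonal_matrix[OF assms] by (auto simp: det_mul det_transpose)

lemma trace_conj_orthogonal:
  fixes M Q :: "real^'n^'n"
  assumes "orthogonal_matrix Q"
  shows "trace (Q ** M ** transpose Q) = trace M"
proof -
  have "trace (Q ** M ** transpose Q) = trace (transpose Q ** Q ** M)"
    by (subst trace_mul_sym) (simp add: matrix_mul_assoc)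
  then show ?thesis using assms by (simp add: orthogonal_matrix_def)
qed

lemma conj_orthogonal_mult:
  fixes M N Q :: "real^'n^'n"
  assumes "orthogonal_matrix Q"
  shows "(Q ** M ** transpose Q) ** (Q ** N ** transpose Q) = Q ** (M ** N) ** transpose Q"
proof -
  have "(Q ** M ** transpose Q) ** (Q ** N ** transpose Q)
      = Q ** M ** (transpose Q ** Q) ** N ** transpose Q"
    by (simp add: matrix_mul_assoc)
  also have "transpose Q ** Q = mat 1" using assms by (simp add: orthogonal_matrix_def)
  finally show ?thesis by (simp add: matrix_mul_assoc)
qed

lemma inner_conj_diag_mat:
  fixes Q :: "real^'n^'n"
  shows "v \<bullet> ((Q ** diag_mat d ** transpose Q) *v v) = (\<Sum>i\<in>UNIV. d i * ((transpose Q *v v) $ i)\<^sup>2)"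
proof -
  have "v \<bullet> ((Q ** diag_mat d ** transpose Q) *v v)
      = (transpose Q *v v) \<bullet> (diag_mat d *v (transpose Q *v v))"
    by (metis dot_lmul_matrix matrix_vector_mul_assoc transpose_matrix_vector)
  then show ?thesis
    by (simp add: inner_vec_def diag_mat_vec power2_eq_square mult.assoc mult.left_commute)
qed

lemma transpose_conj_diag_mat:
  "transpose (Q ** diag_mat d ** transpose Q) = Q ** diag_mat d ** transpose (Q :: real^'n^'n)"
  by (simp add: matrix_transpose_mul matrix_mul_assoc)

text \<open>Column \<open>i\<close> of \<open>Q\<close> is a unit eigenvector for
  \<open>d i\<close>. Hence positivity or an upper bound of the form passes to each eigenvalue,
  which is how the lemma is used below.\<close>

lemma eigenvalue_eq_quadratic_form:
  fixes Q :: "real^'n^'n"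
  assumes "orthogonal_matrix Q"
  shows "d i = (Q *v axis i 1) \<bullet> ((Q ** diag_mat d ** transpose Q) *v (Q *v axis i 1))"
proof -
  have "transpose Q *v (Q *v axis i 1) = axis i 1"
    using assms by (simp add: matrix_vector_mul_assoc orthogonal_matrix_def)
  then show ?thesis
    by (simp add: inner_conj_diag_mat axis_def if_distrib[of "\<lambda>x. x\<^sup>2"] if_distrib[of "(*) _"]
        cong: if_cong)
qed

lemma axis_conj_orthogonal_nonzero:
  fixes Q :: "real^'n^'n"
  assumes "orthogonal_matrix Q"
  shows "Q *v axis i 1 \<noteq> 0"
proof
  assume "Q *v axis i 1 = 0"
  then have "transpose Q *v (Q *v axis i 1) = 0" by simp
  then have "(axis i 1 :: real^'n) = 0"
    using assms by (simp add: matrix_vector_mul_assoc orthogonal_matrix_def)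
  then show False by (simp add: axis_eq_0_iff)
qed

lemma inner_self_eq_sum_orthogonal:
  fixes Q :: "real^'n^'n"
  assumes "orthogonal_matrix Q"
  shows "v \<bullet> v = (\<Sum>i\<in>UNIV. ((transpose Q *v v) $ i)\<^sup>2)"
proof -
  have "v \<bullet> v = (transpose Q *v v) \<bullet> (transpose Q *v v)"
    using assms
    by (metis dot_lmul_matrix matrix_vector_mul_assoc matrix_vector_mul_lid orthogonal_matrix_def
        transpose_matrix_vector)
  also have "\<dots> = (\<Sum>i\<in>UNIV. ((transpose Q *v v) $ i)\<^sup>2)"
    by (simp add: inner_vec_def power2_eq_square)
  finally show ?thesis .
qed

lemma pd_diagonalization:
  fixes H :: "real^'n^'n"
  assumes "transpose H = H" "\<And>v. v \<noteq> 0 \<Longrightarrow> v \<bullet> (H *v v) > 0"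
  obtains Q d where "orthogonal_matrix Q" "H = Q ** diag_mat d ** transpose Q" "\<And>i. d i > 0"
proof -
  obtain Q d where Q: "orthogonal_matrix Q" "H = Q ** diag_mat d ** transpose Q"
    using symmetric_matrix_diagonalization assms(1) by blast
  then have "d i > 0" for i
    using assms(2)[OF axis_conj_orthogonal_nonzero[OF Q(1)]]
    by (subst eigenvalue_eq_quadratic_form[OF Q(1)]) auto
  then show thesis using that Q by blast
qed

text \<open>Turns an order bound, given through the quadratic form, into a bound on the operator
  norm: all eigenvalues lie between 0 and \<open>M\<close>, so those of \<open>A ** A\<close> are at
  most \<open>M\<^sup>2\<close>. This is what confines \<open>x + A *v y\<close> to a small
  ball.\<close>

lemma norm_pd_matrix_vector_le:
  fixes A :: "real^'n^'n"
  assumes A: "transpose A = A" "\<And>v. v \<noteq> 0 \<Longrightarrow> v \<bullet> (A *v v) > 0"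
    and le: "\<And>v. v \<bullet> (A *v v) \<le> M * (v \<bullet> v)" and M: "M \<ge> 0"
  shows "norm (A *v y) \<le> M * norm y"
proof -
  obtain Q d where Q: "orthogonal_matrix Q" "A = Q ** diag_mat d ** transpose Q"
    and d: "\<And>i. d i > 0"
    using pd_diagonalization[OF A] by blast
  have dM: "d i \<le> M" for i
  proof -
    have "d i \<le> M * ((Q *v axis i 1) \<bullet> (Q *v axis i 1))"
      using le by (subst eigenvalue_eq_quadratic_form[OF Q(1)]) (simp add: Q(2))
    also have "(Q *v axis i 1) \<bullet> (Q *v axis i 1) = axis i 1 \<bullet> (axis i 1 :: real^'n)"
      using inner_self_eq_sum_orthogonal[OF Q(1), of "Q *v axis i 1"] Q(1)
      by (simp add: matrix_vector_mul_assoc orthogonal_matrix_def inner_vec_def power2_eq_square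
          del: transpose_matrix_vector)
    finally show ?thesis by (simp add: inner_axis_axis)
  qed
  have "(A *v y) \<bullet> (A *v y) = y \<bullet> ((A ** A) *v y)"
    by (simp add: symmetric_matrix_inner[OF A(1)] matrix_vector_mul_assoc)
  also have "A ** A = Q ** diag_mat (\<lambda>i. d i * d i) ** transpose Q"
    by (simp add: Q(2) conj_orthogonal_mult[OF Q(1)] diag_mat_mult)
  also have "y \<bullet> (\<dots> *v y) \<le> M\<^sup>2 * (y \<bullet> y)"
    unfolding inner_conj_diag_mat inner_self_eq_sum_orthogonal[OF Q(1)] sum_distrib_left power2_eq_square[of M]
    using dM d M by (intro sum_mono mult_right_mono mult_mono) (auto simp: less_imp_le)
  finally have "(norm (A *v y))\<^sup>2 \<le> (M * norm y)\<^sup>2"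
    by (simp add: dot_square_norm power_mult_distrib)
  then show ?thesis by (rule power2_le_imp_le) (use M in simp)
qed

definition psd :: "real^'n^'n \<Rightarrow> bool" where
  "psd H \<longleftrightarrow> transpose H = H \<and> (\<forall>v. v \<bullet> (H *v v) \<ge> 0)"

lemma psd_diagonalization:
  fixes H :: "real^'n^'n"
  assumes "psd H"
  obtains Q d where "orthogonal_matrix Q" "H = Q ** diag_mat d ** transpose Q" "\<And>i. d i \<ge> 0"
proof -
  obtain Q d where Q: "orthogonal_matrix Q" "H = Q ** diag_mat d ** transpose Q"
    using symmetric_matrix_diagonalization assms unfolding psd_def by blast
  then have "d i \<ge> 0" for i
    using assms by (subst eigenvalue_eq_quadratic_form[OF Q(1)]) (auto simp: psd_def)
  then show thesis using that Q by blast
qed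

lemma det_psd_nonneg: "psd (H :: real^'n^'n) \<Longrightarrow> det H \<ge> 0"
  by (erule psd_diagonalization) (simp add: det_conj_orthogonal det_diag_mat prod_nonneg)

lemma psd_pos_det_imp_pd:
  fixes H :: "real^'n^'n"
  assumes "psd H" "det H > 0"
  obtains m where "m > 0" "\<And>v. v \<bullet> (H *v v) \<ge> m * (v \<bullet> v)"
proof -
  obtain Q d where Q: "orthogonal_matrix Q" "H = Q ** diag_mat d ** transpose Q" "\<And>i. d i \<ge> 0"
    using psd_diagonalization[OF assms(1)] by blast
  have "prod d UNIV > 0" using assms(2) Q by (simp add: det_conj_orthogonal det_diag_mat)
  then have dpos: "d i > 0" for i
    using Q(3)[of i] by (metis UNIV_I finite_code less_irrefl order_le_less prod_zero_iff)
  define m where "m = Min (range d)"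
  have mle: "m \<le> d i" for i by (simp add: m_def)
  show thesis
  proof
    show "m > 0" using dpos by (simp add: m_def)
    fix v :: "real^'n"
    show "v \<bullet> (H *v v) \<ge> m * (v \<bullet> v)"
      unfolding Q(2) inner_conj_diag_mat inner_self_eq_sum_orthogonal[OF Q(1)] sum_distrib_left
      by (intro sum_mono mult_right_mono mle) simp
  qed
qed

section \<open>The matrix form of the arithmetic-geometric mean inequality\<close>

text \<open>AM-GM for \<open>n + 1\<close> nonnegative numbers: the \<open>n\<close> eigenvalues of
  \<open>A ** H ** A\<close> and \<open>p * b\<^sup>2\<close>. By \<open>b * det A = 1\<close> their
  product is \<open>p * det H\<close>, whatever \<open>A\<close> and \<open>b\<close> are.\<close>

lemma trace_plus_ge_det:
  fixes H A :: "real^'n^'n"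
  assumes H: "psd H" and p: "p \<ge> 0" and A: "transpose A = A" and bA: "b * det A = 1"
  shows "trace (A ** H ** A) + p * b\<^sup>2
           \<ge> (real CARD('n) + 1) * (p * det H) powr (1 / (real CARD('n) + 1))"
proof -
  have "psd (A ** H ** A)"
    unfolding psd_def
  proof
    show "transpose (A ** H ** A) = A ** H ** A"
      using A H by (simp add: matrix_transpose_mul matrix_mul_assoc psd_def)
    have "v \<bullet> (A ** H ** A *v v) = (A *v v) \<bullet> (H *v (A *v v))" for v
      by (simp add: symmetric_matrix_inner[OF A] matrix_vector_mul_assoc[symmetric])
    then show "\<forall>v. v \<bullet> (A ** H ** A *v v) \<ge> 0" using H by (simp add: psd_def)
  qed
  then obtain Q d where Q: "orthogonal_matrix Q" "A ** H ** A = Q ** diag_mat d ** transpose Q"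
      and d: "\<And>i. d i \<ge> 0"
    using psd_diagonalization by blast
  have tr: "trace (A ** H ** A) = sum d UNIV"
    by (simp add: Q trace_conj_orthogonal trace_diag_mat)
  have dt: "(det A)\<^sup>2 * det H = prod d UNIV"
    using arg_cong[OF Q(2), of det] unfolding det_conj_orthogonal[OF Q(1)]
    by (simp add: det_mul det_diag_mat power2_eq_square ac_simps)
  \<comment> \<open>The type \<open>'n option\<close> provides the \<open>n + 1\<close> indices:
    \<open>None\<close> stands for \<open>p * b\<^sup>2\<close>, \<open>Some i\<close> for the
    eigenvalue \<open>d i\<close>.\<close>
  define x where "x = case_option (p * b\<^sup>2) d"
  have "(\<Sum>i\<in>UNIV. x i / card (UNIV :: 'n option set))
         \<ge> (\<Prod>i\<in>UNIV. x i) powr (1 / card (UNIV :: 'n option set))"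
    by (rule arith_geom_mean) (use p d in \<open>auto simp: x_def split: option.split\<close>)
  moreover have "sum x UNIV = p * b\<^sup>2 + sum d UNIV"
    by (simp add: UNIV_option_conv x_def sum.reindex)
  moreover have "prod x UNIV = p * b\<^sup>2 * prod d UNIV"
    by (simp add: UNIV_option_conv x_def prod.reindex)
  moreover have "p * b\<^sup>2 * prod d UNIV = p * det H"
    using arg_cong[OF bA, of "\<lambda>r. r\<^sup>2"] unfolding dt[symmetric]
    by (simp add: power_mult_distrib mult.assoc[symmetric])
  moreover have "card (UNIV :: 'n option set) = CARD('n) + 1"
    by (simp add: card_UNIV_option)
  ultimately have "(p * det H) powr (1 / (real CARD('n) + 1))
      \<le> (p * b\<^sup>2 + sum d UNIV) / (real CARD('n) + 1)"
    by (simp only: sum_divide_distrib[symmetric] of_nat_add of_nat_1)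
  then show ?thesis
    by (simp add: tr le_divide_eq add.commute mult.commute)
qed

text \<open>The equality case of AM-GM asks all \<open>n + 1\<close> numbers to equal their
  geometric mean \<open>c\<close>. So \<open>A\<close> gets the eigenvectors of \<open>H\<close>
  with eigenvalues \<open>sqrt (c / d i)\<close>, which makes \<open>A ** H ** A\<close> equal to
  \<open>c\<close> times the identity; \<open>b\<close> is then forced by the constraint.\<close>

lemma trace_plus_eq_det:
  fixes H :: "real^'n^'n"
  assumes H: "transpose H = H" "\<And>v. v \<noteq> 0 \<Longrightarrow> v \<bullet> (H *v v) > 0" and p: "p > 0"
  obtains A b where "transpose A = A" "\<And>v. v \<noteq> 0 \<Longrightarrow> v \<bullet> (A *v v) > 0" "b > 0" "b * det A = 1"
    "trace (A ** H ** A) + p * b\<^sup>2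
       = (real CARD('n) + 1) * (p * det H) powr (1 / (real CARD('n) + 1))"
proof -
  obtain Q d where Q: "orthogonal_matrix Q" "H = Q ** diag_mat d ** transpose Q"
    and d: "\<And>i. d i > 0"
    using pd_diagonalization[OF H] by blast
  have detH: "det H = prod d UNIV" by (simp add: Q det_conj_orthogonal det_diag_mat)
  have detpos: "det H > 0" using d by (simp add: detH prod_pos)
  define c where "c = (p * det H) powr (1 / (real CARD('n) + 1))"
  have c: "c > 0" using p detpos by (simp add: c_def)
  have cn: "c ^ (CARD('n) + 1) = p * det H"
  proof -
    have "c ^ (CARD('n) + 1) = c powr (real CARD('n) + 1)"
      using c powr_realpow[of c "CARD('n) + 1"] by (simp add: add.commute)
    also have "\<dots> = p * det H" using p detpos by (simp add: c_def powr_powr)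
    finally show ?thesis .
  qed
  define a where "a i = sqrt (c / d i)" for i
  have a: "a i > 0" for i using c d by (simp add: a_def)
  have a2: "a i * d i * a i = c" for i
  proof -
    have "a i * a i = c / d i" using c d[of i] by (simp add: a_def)
    then have "d i * (a i * a i) = c" using d[of i] by simp
    then show ?thesis by (simp add: ac_simps)
  qed
  define A where "A = Q ** diag_mat a ** transpose Q"
  have detA: "det A = prod a UNIV" by (simp add: A_def Q det_conj_orthogonal det_diag_mat)
  have detApos: "det A > 0" using a by (simp add: detA prod_pos)
  define b where "b = 1 / det A"
  have AHA: "A ** H ** A = Q ** diag_mat (\<lambda>i. c) ** transpose Q"
    by (simp add: A_def Q(2) conj_orthogonal_mult[OF Q(1)] diag_mat_mult a2)
  have "(det A)\<^sup>2 * det H = c ^ CARD('n)"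
    using arg_cong[OF AHA, of det] unfolding det_conj_orthogonal[OF Q(1)]
    by (simp add: det_mul det_diag_mat power2_eq_square ac_simps)
  \<comment> \<open>The determinant of \<open>A ** H ** A\<close>, multiplied by \<open>p\<close>
    and combined with \<open>cn\<close>, shows that the forced \<open>b\<close> also satisfies
    \<open>p * b\<^sup>2 = c\<close>.\<close>
  then have "p * c ^ CARD('n) = (det A)\<^sup>2 * (c * c ^ CARD('n))"
    using cn by (simp add: ac_simps)
  then have "p = (det A)\<^sup>2 * c" using c by (simp add: ac_simps)
  then have pb: "p * b\<^sup>2 = c" using detApos by (simp add: b_def power_divide)
  show thesis
  proof
    show "transpose A = A" by (simp add: A_def transpose_conj_diag_mat)
    show "b > 0" "b * det A = 1" using detApos by (auto simp: b_def)
    have "trace (A ** H ** A) = real CARD('n) * c"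
      by (simp add: AHA trace_conj_orthogonal[OF Q(1)] trace_diag_mat)
    then show "trace (A ** H ** A) + p * b\<^sup>2
       = (real CARD('n) + 1) * (p * det H) powr (1 / (real CARD('n) + 1))"
      unfolding pb c_def[symmetric] by (simp add: algebra_simps)
    fix v :: "real^'n" assume v: "v \<noteq> 0"
    have nz: "transpose Q *v v \<noteq> 0"
    proof
      assume "transpose Q *v v = 0"
      then have "Q *v (transpose Q *v v) = 0" by simp
      moreover have "Q *v (transpose Q *v v) = v"
        using Q(1) by (metis matrix_vector_mul_assoc matrix_vector_mul_lid orthogonal_matrix_def)
      ultimately show False using v by simp
    qed
    then obtain i where "(transpose Q *v v) $ i \<noteq> 0" by (auto simp: vec_eq_iff)
    then have "0 < a i * ((transpose Q *v v) $ i)\<^sup>2" using a by simp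
    also have "\<dots> \<le> (\<Sum>i\<in>UNIV. a i * ((transpose Q *v v) $ i)\<^sup>2)"
      by (rule member_le_sum) (use a in \<open>auto simp: less_imp_le\<close>)
    finally show "v \<bullet> (A *v v) > 0" by (simp add: A_def inner_conj_diag_mat)
  qed
qed

section \<open>Moments of the uniform distribution on a ball\<close>

lemma prod_Basis_cart: "(\<Prod>b\<in>Basis. (x :: real^'n) \<bullet> b) = (\<Prod>i\<in>UNIV. x $ i)"
proof -
  have B: "(Basis :: (real^'n) set) = range (\<lambda>i. axis i 1)"
    by (auto simp: Basis_vec_def)
  have "inj (\<lambda>i. axis i 1 :: real^'n)"
    by (auto simp: inj_def axis_eq_axis)
  then show ?thesis
    unfolding B by (subst prod.reindex) (simp_all add: inner_axis)
qed

text \<open>One family covers all isometries needed: the point reflection, the sign change of one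
  coordinate and the swap of two coordinates.\<close>

definition signed_perm :: "('n \<Rightarrow> real) \<Rightarrow> ('n \<Rightarrow> 'n) \<Rightarrow> real^'n \<Rightarrow> real^'n" where
  "signed_perm c \<pi> y = (\<chi> i. c i * y $ \<pi> i)"

lemma continuous_signed_perm: "continuous_on UNIV (signed_perm c \<pi>)"
  unfolding signed_perm_def by (intro continuous_intros)

lemma measurable_signed_perm [measurable]: "signed_perm c \<pi> \<in> borel_measurable borel"
  by (rule borel_measurable_continuous_onI[OF continuous_signed_perm])

text \<open>Lebesgue measure is determined by its values on boxes, and the preimage of a box is a
  box with the same edge lengths in permuted order. Taking \<open>\<pi>\<close> to be an involution
  makes it its own inverse in every reindexing.\<close>

lemma lborel_distr_signed_perm:
  fixes c :: "'n::finite \<Rightarrow> real"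
  assumes c: "\<And>i. c i = 1 \<or> c i = -1" and \<pi>: "\<And>i. \<pi> (\<pi> i) = i"
  shows "distr lborel borel (signed_perm c \<pi>) = lborel"
proof (rule lborel_eqI[symmetric])
  fix l u :: "real^'n" assume le: "\<And>b. b \<in> Basis \<Longrightarrow> l \<bullet> b \<le> u \<bullet> b"
  have le': "l $ i \<le> u $ i" for i
    using le[of "axis i 1"] by (simp add: inner_axis axis_in_Basis_iff)
  \<comment> \<open>Coordinate \<open>i\<close> of \<open>y\<close> shows up in coordinate
    \<open>\<pi> i\<close> of the image; a factor -1 there reflects the edge and exchanges its end
    points.\<close>
  define l' u' where "l' = (\<chi> i. if c (\<pi> i) = 1 then l $ \<pi> i else - u $ \<pi> i)"
    and "u' = (\<chi> i. if c (\<pi> i) = 1 then u $ \<pi> i else - l $ \<pi> i)"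
  have "signed_perm c \<pi> y \<in> box l u \<longleftrightarrow> y \<in> box l' u'" for y
  proof -
    have "signed_perm c \<pi> y \<in> box l u \<longleftrightarrow> (\<forall>i. l $ i < c i * y $ \<pi> i \<and> c i * y $ \<pi> i < u $ i)"
      by (simp add: mem_box_cart signed_perm_def)
    also have "\<dots> \<longleftrightarrow> (\<forall>i. l $ \<pi> i < c (\<pi> i) * y $ i \<and> c (\<pi> i) * y $ i < u $ \<pi> i)"
      by (metis \<pi>)
    also have "\<dots> \<longleftrightarrow> (\<forall>i. l' $ i < y $ i \<and> y $ i < u' $ i)"
    proof (intro arg_cong[where f = All] ext)
      fix i
      show "(l $ \<pi> i < c (\<pi> i) * y $ i \<and> c (\<pi> i) * y $ i < u $ \<pi> i)
          \<longleftrightarrow> (l' $ i < y $ i \<and> y $ i < u' $ i)"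
        using c[of "\<pi> i"] by (auto simp: l'_def u'_def)
    qed
    finally show ?thesis by (simp add: mem_box_cart)
  qed
  then have "signed_perm c \<pi> -` box l u = box l' u'" by auto
  moreover have "l' $ i \<le> u' $ i" for i
    using le'[of "\<pi> i"] by (auto simp: l'_def u'_def)
  then have "l' \<bullet> b \<le> u' \<bullet> b" if "b \<in> Basis" for b
    using that by (auto simp: Basis_vec_def inner_axis)
  then have "emeasure lborel (box l' u') = (\<Prod>b\<in>Basis. (u' - l') \<bullet> b)"
    by simp
  moreover have "(\<Prod>i\<in>UNIV. (u' - l') $ i) = (\<Prod>i\<in>UNIV. (u - l) $ \<pi> i)"
    by (rule prod.cong) (auto simp: l'_def u'_def)
  moreover have "\<dots> = (\<Prod>i\<in>UNIV. (u - l) $ i)"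
    by (rule prod.reindex_bij_witness[of _ \<pi> \<pi>]) (auto simp: \<pi>)
  ultimately show "emeasure (distr lborel borel (signed_perm c \<pi>)) (box l u)
      = (\<Prod>b\<in>Basis. (u - l) \<bullet> b)"
    by (simp add: emeasure_distr prod_Basis_cart)
qed simp

lemma norm_signed_perm:
  fixes c :: "'n::finite \<Rightarrow> real"
  assumes c: "\<And>i. c i = 1 \<or> c i = -1" and \<pi>: "\<And>i. \<pi> (\<pi> i) = i"
  shows "norm (signed_perm c \<pi> y) = norm y"
proof -
  have "(c i * y $ \<pi> i)\<^sup>2 = (y $ \<pi> i)\<^sup>2" for i
    using c[of i] by auto
  then have "(\<Sum>i\<in>UNIV. (c i * y $ \<pi> i)\<^sup>2) = (\<Sum>i\<in>UNIV. (y $ \<pi> i)\<^sup>2)" by simp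
  also have "\<dots> = (\<Sum>i\<in>UNIV. (y $ i)\<^sup>2)"
    by (rule sum.reindex_bij_witness[of _ \<pi> \<pi>]) (auto simp: \<pi>)
  finally show ?thesis by (simp add: norm_vec_def L2_set_def signed_perm_def)
qed

lemma set_integrable_continuous_on_cball:
  fixes g :: "'a::euclidean_space \<Rightarrow> real"
  assumes "continuous_on (cball x e) g"
  shows "set_integrable lborel (ball x e) g"
proof (rule set_integrable_subset)
  show "set_integrable lborel (cball x e) g"
    unfolding set_integrable_def by (rule borel_integrable_compact) (use assms in auto)
qed (auto simp: subset_iff)

lemma integrable_on_ball_continuous:
  fixes g :: "'a::euclidean_space \<Rightarrow> real"
  assumes "continuous_on (cball x e) g"
  shows "g integrable_on ball x e"
  using set_borel_integral_eq_integral(1)[OF set_integrable_continuous_on_cball[OF assms]] .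

text \<open>Change of variables for an isometry of the ball. Sign changes will show that linear and
  mixed moments vanish, swaps that all coordinates have the same second moment.\<close>

lemma integral_ball_signed_perm:
  fixes g :: "real^'n \<Rightarrow> real"
  assumes c: "\<And>i. c i = 1 \<or> c i = -1" and \<pi>: "\<And>i. \<pi> (\<pi> i) = i"
    and g: "continuous_on (cball 0 e) g"
  shows "integral (ball 0 e) (\<lambda>y. g (signed_perm c \<pi> y)) = integral (ball 0 e) g"
proof -
  let ?T = "signed_perm c \<pi>"
  note int = set_integrable_continuous_on_cball[OF g]
  have cgT: "continuous_on (cball 0 e) (\<lambda>y. g (?T y))"
    by (rule continuous_on_compose2[OF g continuous_on_subset[OF continuous_signed_perm]])
       (auto simp: norm_signed_perm[OF c \<pi>])
  have "integral (ball 0 e) g = (LINT y|lborel. indicator (ball 0 e) y *\<^sub>R g y)"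
    using set_borel_integral_eq_integral(2)[OF int]
    by (simp add: set_lebesgue_integral_def)
  also have "\<dots> = (LINT y|distr lborel borel ?T. indicator (ball 0 e) y *\<^sub>R g y)"
    by (simp add: lborel_distr_signed_perm[OF c \<pi>])
  also have "\<dots> = (LINT y|lborel. indicator (ball 0 e) (?T y) *\<^sub>R g (?T y))"
    using borel_measurable_integrable[OF int[unfolded set_integrable_def]]
    by (intro integral_distr) auto
  also have "\<dots> = (LINT y|lborel. indicator (ball 0 e) y *\<^sub>R g (?T y))"
    by (simp add: indicator_def norm_signed_perm[OF c \<pi>])
  also have "\<dots> = integral (ball 0 e) (\<lambda>y. g (?T y))"
    using set_borel_integral_eq_integral(2)[OF set_integrable_continuous_on_cball[OF cgT]]
    by (simp add: set_lebesgue_integral_def)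
  finally show ?thesis by simp
qed

lemma integral_ball_component: "integral (ball 0 e) (\<lambda>y::real^'n. y $ i) = 0"
proof -
  have "integral (ball 0 e) (\<lambda>y::real^'n. signed_perm (\<lambda>_. -1) id y $ i)
      = integral (ball 0 e) (\<lambda>y::real^'n. y $ i)"
    by (rule integral_ball_signed_perm) (auto intro: continuous_intros)
  then show ?thesis by (simp add: signed_perm_def)
qed

lemma integral_ball_component_mult:
  assumes "i \<noteq> j"
  shows "integral (ball 0 e) (\<lambda>y::real^'n. y $ i * y $ j) = 0"
proof -
  let ?T = "signed_perm (\<lambda>k. if k = i then -1 else 1) id"
  have "integral (ball 0 e) (\<lambda>y::real^'n. ?T y $ i * ?T y $ j)
      = integral (ball 0 e) (\<lambda>y::real^'n. y $ i * y $ j)"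
    by (rule integral_ball_signed_perm) (auto intro!: continuous_intros)
  then show ?thesis using assms by (simp add: signed_perm_def)
qed

lemma integral_ball_component_square_eq:
  "integral (ball 0 e) (\<lambda>y::real^'n. (y $ i)\<^sup>2) = integral (ball 0 e) (\<lambda>y::real^'n. (y $ j)\<^sup>2)"
proof -
  let ?T = "signed_perm (\<lambda>k. 1) (Transposition.transpose i j)"
  have "integral (ball 0 e) (\<lambda>y::real^'n. (?T y $ i)\<^sup>2)
      = integral (ball 0 e) (\<lambda>y::real^'n. (y $ i)\<^sup>2)"
    by (rule integral_ball_signed_perm) (auto intro!: continuous_intros)
  then show ?thesis by (simp add: signed_perm_def)
qed

text \<open>Integrate \<open>(norm y)\<^sup>2\<close> as the integral of \<open>2 * r\<close> over \<open>0 \<le> r \<le> norm y\<close>, and exchange the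
  order of integration.\<close>

lemma nn_integral_ball_norm_square:
  assumes e: "e > 0"
  shows "(\<integral>\<^sup>+y. ennreal ((norm y)\<^sup>2) * indicator (ball (0::'a::euclidean_space) e) y \<partial>lborel)
    = ennreal (real DIM('a) / (real DIM('a) + 2) * e\<^sup>2 * measure lborel (ball (0::'a) e))"
proof -
  define n where "n = DIM('a)"
  define V where "V = unit_ball_vol n"
  have V: "V \<ge> 0" by (simp add: V_def)
  let ?f = "\<lambda>(y::'a) r::real. ennreal (2 * r) * indicator {0..norm y} r * indicator (ball 0 e) y"
  have inner1: "(\<integral>\<^sup>+r. ?f y r \<partial>lborel) = ennreal ((norm y)\<^sup>2) * indicator (ball 0 e) y" for y
  proof -
    have "(\<integral>\<^sup>+r. ennreal (2 * r) * indicator {0..norm y} r \<partial>lborel)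
        = ennreal ((norm y)\<^sup>2 - 0\<^sup>2)"
      by (rule nn_integral_FTC_Icc) (auto intro!: derivative_eq_intros)
    then show ?thesis by (simp add: nn_integral_multc)
  qed
  \<comment> \<open>For fixed \<open>r\<close> between 0 and \<open>e\<close> the points
    \<open>y\<close> fill a spherical shell, of volume \<open>V * e ^ n - V * r ^ n\<close>.\<close>
  have inner2: "(\<integral>\<^sup>+y. ?f y r \<partial>lborel)
      = ennreal (2 * r * (V * e ^ n - V * r ^ n)) * indicator {0..e} r" for r
  proof (cases "0 \<le> r \<and> r \<le> e")
    case True
    have "(\<integral>\<^sup>+y. ?f y r \<partial>lborel)
        = (\<integral>\<^sup>+y. ennreal (2 * r) * indicator (ball (0::'a) e - ball 0 r) y \<partial>lborel)"
      by (rule nn_integral_cong) (use True in \<open>auto simp: indicator_def\<close>)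
    also have "\<dots> = ennreal (2 * r) * emeasure lborel (ball (0::'a) e - ball 0 r)"
      by (subst nn_integral_cmult_indicator) auto
    also have "emeasure lborel (ball (0::'a) e - ball 0 r)
        = emeasure lborel (ball (0::'a) e) - emeasure lborel (ball (0::'a) r)"
      using emeasure_lborel_ball_finite[of "0::'a" r] True
      by (intro emeasure_Diff) (auto simp: subset_ball)
    also have "\<dots> = ennreal (V * e ^ n - V * r ^ n)"
      using True e V by (simp add: emeasure_ball V_def n_def ennreal_minus)
    finally show ?thesis using True by (simp add: ennreal_mult')
  next
    case False
    have "(\<integral>\<^sup>+y. ?f y r \<partial>lborel) = (\<integral>\<^sup>+y. 0 \<partial>(lborel :: 'a measure))"
      by (rule nn_integral_cong) (use False in \<open>auto simp: indicator_def\<close>)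
    then show ?thesis using False by (auto simp: indicator_def)
  qed
  have [measurable]: "case_prod ?f \<in> borel_measurable (lborel \<Otimes>\<^sub>M lborel)"
    unfolding indicator_def atLeastAtMost_iff mem_ball by measurable
  have "(\<integral>\<^sup>+y. ennreal ((norm y)\<^sup>2) * indicator (ball (0::'a) e) y \<partial>lborel)
      = (\<integral>\<^sup>+r. (\<integral>\<^sup>+y. ?f y r \<partial>lborel) \<partial>lborel)"
    by (subst lborel_pair.Fubini') (simp_all add: inner1)
  also have "\<dots> = (\<integral>\<^sup>+r. ennreal (2 * r * (V * e ^ n - V * r ^ n)) * indicator {0..e} r \<partial>lborel)"
    by (simp only: inner2)
  also have "\<dots> = ennreal ((V * e ^ n * e\<^sup>2 - 2 * V / (real n + 2) * e ^ (n + 2))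
      - (V * e ^ n * 0\<^sup>2 - 2 * V / (real n + 2) * 0 ^ (n + 2)))"
  proof (rule nn_integral_FTC_Icc[where F = "\<lambda>r. V * e ^ n * r\<^sup>2 - 2 * V / (real n + 2) * r ^ (n + 2)"])
    fix r assume r: "r \<in> {0..e}"
    have "((\<lambda>r. r ^ (n + 2)) has_real_derivative (real n + 2) * r ^ (n + 1)) (at r)"
      using DERIV_pow[of "n + 2" r UNIV] by (simp add: add.commute)
    moreover have "((\<lambda>r. r\<^sup>2) has_real_derivative 2 * r) (at r)"
      using DERIV_pow[of 2 r UNIV] by simp
    ultimately have "((\<lambda>r. V * e ^ n * r\<^sup>2 - 2 * V / (real n + 2) * r ^ (n + 2)) has_real_derivative
        V * e ^ n * (2 * r) - 2 * V / (real n + 2) * ((real n + 2) * r ^ (n + 1))) (at r)"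
      by (intro DERIV_diff DERIV_cmult)
    then show "((\<lambda>r. V * e ^ n * r\<^sup>2 - 2 * V / (real n + 2) * r ^ (n + 2)) has_real_derivative
        2 * r * (V * e ^ n - V * r ^ n)) (at r)"
      by (rule DERIV_cong) (simp add: field_simps)
    show "0 \<le> 2 * r * (V * e ^ n - V * r ^ n)"
      using r V by (intro mult_nonneg_nonneg) (auto intro!: mult_left_mono power_mono)
  qed (use e in auto)
  also have "(V * e ^ n * e\<^sup>2 - 2 * V / (real n + 2) * e ^ (n + 2))
      - (V * e ^ n * 0\<^sup>2 - 2 * V / (real n + 2) * 0 ^ (n + 2))
      = real n / (real n + 2) * e\<^sup>2 * (V * e ^ n)"
    by (simp add: field_simps power_add power2_eq_square)
  also have "V * e ^ n = measure lborel (ball (0::'a) e)"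
    using e by (simp add: content_ball V_def n_def)
  finally show ?thesis by (simp add: n_def)
qed

lemma integral_ball_norm_square:
  assumes e: "e > 0"
  shows "integral (ball (0::'a::euclidean_space) e) (\<lambda>y. (norm y)\<^sup>2)
    = real DIM('a) / (real DIM('a) + 2) * e\<^sup>2 * measure lborel (ball (0::'a) e)"
proof -
  have "set_integrable lborel (ball (0::'a) e) (\<lambda>y. (norm y)\<^sup>2)"
    by (rule set_integrable_continuous_on_cball) (intro continuous_intros)
  from set_borel_integral_eq_integral(2)[OF this]
  have "integral (ball (0::'a) e) (\<lambda>y. (norm y)\<^sup>2)
      = (LINT y|lborel. indicator (ball (0::'a) e) y *\<^sub>R (norm y)\<^sup>2)"
    by (simp add: set_lebesgue_integral_def)
  also have "\<dots> = enn2real (\<integral>\<^sup>+y. ennreal ((norm y)\<^sup>2) * indicator (ball (0::'a) e) y \<partial>lborel)"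
    by (subst integral_eq_nn_integral)
       (auto intro!: arg_cong[where f = enn2real] nn_integral_cong simp: indicator_def)
  finally show ?thesis
    by (simp add: nn_integral_ball_norm_square[OF e])
qed

text \<open>The squares of the coordinates sum to \<open>(norm y)\<^sup>2\<close> and have equal
  integrals, so each takes the share \<open>1 / n\<close>, and the factor \<open>n / (n + 2)\<close>
  becomes \<open>1 / (n + 2)\<close>.\<close>

lemma integral_ball_component_square:
  assumes e: "e > 0"
  shows "integral (ball 0 e) (\<lambda>y::real^'n. (y $ i)\<^sup>2)
    = e\<^sup>2 / (real CARD('n) + 2) * measure lborel (ball (0::real^'n) e)"
proof -
  have "real CARD('n) / (real CARD('n) + 2) * e\<^sup>2 * measure lborel (ball (0::real^'n) e)
      = integral (ball (0::real^'n) e) (\<lambda>y. (norm y)\<^sup>2)"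
    using integral_ball_norm_square[OF e, where 'a = "real^'n"] by simp
  also have "\<dots> = integral (ball (0::real^'n) e) (\<lambda>y. \<Sum>j\<in>UNIV. (y $ j)\<^sup>2)"
    by (simp add: norm_vec_def L2_set_def sum_nonneg)
  also have "\<dots> = (\<Sum>j\<in>UNIV. integral (ball (0::real^'n) e) (\<lambda>y. (y $ j)\<^sup>2))"
    by (intro integral_sum integrable_on_ball_continuous continuous_intros) auto
  also have "\<dots> = real CARD('n) * integral (ball (0::real^'n) e) (\<lambda>y. (y $ i)\<^sup>2)"
    by (subst integral_ball_component_square_eq[of e _ i]) simp
  finally have "real CARD('n) * (e\<^sup>2 / (real CARD('n) + 2) * measure lborel (ball (0::real^'n) e))
      = real CARD('n) * integral (ball (0::real^'n) e) (\<lambda>y. (y $ i)\<^sup>2)"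
    by (simp add: mult.assoc)
  then show ?thesis by (subst (asm) mult_left_cancel) simp_all
qed

lemma integral_ball_linear:
  fixes g :: "real^'n"
  shows "integral (ball 0 e) (\<lambda>y. g \<bullet> (A *v y)) = 0"
proof -
  have "integral (ball 0 e) (\<lambda>y. g \<bullet> (A *v y))
      = integral (ball 0 e) (\<lambda>y. \<Sum>i\<in>UNIV. (g v* A) $ i * y $ i)"
    by (simp add: dot_lmul_matrix[symmetric, of g]) (simp add: inner_vec_def)
  also have "\<dots> = (\<Sum>i\<in>UNIV. integral (ball 0 e) (\<lambda>y. (g v* A) $ i * y $ i))"
    by (intro integral_sum integrable_on_ball_continuous continuous_intros) auto
  also have "\<dots> = 0" by (simp add: integral_ball_component)
  finally show ?thesis .
qed

lemma integral_ball_quadratic: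
  fixes M :: "real^'n^'n"
  assumes e: "e > 0"
  shows "integral (ball 0 e) (\<lambda>y. y \<bullet> (M *v y))
    = trace M * e\<^sup>2 / (real CARD('n) + 2) * measure lborel (ball (0::real^'n) e)"
proof -
  have "integral (ball 0 e) (\<lambda>y. y \<bullet> (M *v y))
      = integral (ball 0 e) (\<lambda>y. \<Sum>i\<in>UNIV. \<Sum>j\<in>UNIV. M $ i $ j * (y $ i * y $ j))"
    by (simp add: inner_vec_def matrix_vector_mult_def sum_distrib_left ac_simps)
  also have "\<dots> = (\<Sum>i\<in>UNIV. \<Sum>j\<in>UNIV. M $ i $ j * integral (ball 0 e) (\<lambda>y. y $ i * y $ j))"
    by (simp add: integral_sum integrable_sum integrable_on_ball_continuous continuous_intros)
  also have "\<dots> = (\<Sum>i\<in>UNIV. \<Sum>j\<in>UNIV. if j = i then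
      M $ i $ i * (e\<^sup>2 / (real CARD('n) + 2) * measure lborel (ball (0::real^'n) e)) else 0)"
    using integral_ball_component_square[OF e, where 'n = 'n]
    by (intro sum.cong refl) (auto simp: integral_ball_component_mult power2_eq_square)
  also have "\<dots> = trace M * e\<^sup>2 / (real CARD('n) + 2) * measure lborel (ball (0::real^'n) e)"
    by (simp add: trace_def sum_distrib_right sum_divide_distrib mult.assoc)
  finally show ?thesis .
qed

section \<open>Second-order Taylor expansion\<close>

lemma DERIV_along_line:
  fixes f :: "'a::real_inner \<Rightarrow> real"
  assumes "(f has_derivative (\<lambda>h. G \<bullet> h)) (at (a + \<tau> *\<^sub>R z))"
  shows "((\<lambda>\<tau>. f (a + \<tau> *\<^sub>R z)) has_real_derivative G \<bullet> z) (at \<tau>)"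
proof -
  have "((\<lambda>\<tau>. a + \<tau> *\<^sub>R z) has_derivative (\<lambda>h. h *\<^sub>R z)) (at \<tau>)"
    by (auto intro!: derivative_eq_intros)
  from has_derivative_compose[OF this assms] show ?thesis
    by (simp add: has_field_derivative_def mult_commute_abs)
qed

lemma has_derivative_remainder_bound:
  assumes "(g has_derivative L) (at x)" "\<eta> > 0"
  obtains \<delta> where "\<delta> > 0" "\<And>z. norm z < \<delta> \<Longrightarrow> norm (g (x + z) - g x - L z) \<le> \<eta> * norm z"
proof -
  obtain \<delta> where \<delta>: "\<delta> > 0"
    "\<And>y. norm (y - x) < \<delta> \<Longrightarrow> norm (g y - g x - L (y - x)) \<le> \<eta> * norm (y - x)"
    using assms unfolding has_derivative_at_alt by blast
  show thesis
    by (rule that[OF \<delta>(1)]) (use \<delta>(2)[of "x + _"] in simp)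
qed

text \<open>Peano form, with the gradient differentiable at the single point \<open>x\<close>. The
  mean value theorem, applied along the segment to \<open>f\<close> minus its quadratic model,
  leaves the first-order remainder of the gradient times \<open>z\<close>.\<close>

lemma second_order_taylor:
  fixes f :: "'a::real_inner \<Rightarrow> real"
  assumes r: "r > 0" and f: "\<And>y. y \<in> ball x r \<Longrightarrow> (f has_derivative (\<lambda>h. g y \<bullet> h)) (at y)"
    and g: "(g has_derivative L) (at x)" and \<eta>: "\<eta> > 0"
  obtains \<delta> where "\<delta> > 0" "\<delta> \<le> r"
    "\<And>z. norm z < \<delta> \<Longrightarrow> \<bar>f (x + z) - f x - g x \<bullet> z - (L z \<bullet> z) / 2\<bar> \<le> \<eta> * (norm z)\<^sup>2"
proof -
  interpret L: bounded_linear L using g by (rule has_derivative_bounded_linear)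
  obtain \<delta>0 where \<delta>0: "\<delta>0 > 0"
    "\<And>z. norm z < \<delta>0 \<Longrightarrow> norm (g (x + z) - g x - L z) \<le> \<eta> * norm z"
    using has_derivative_remainder_bound[OF g \<eta>] by blast
  show thesis
  proof (rule that[of "min \<delta>0 r"])
    fix z :: 'a assume z: "norm z < min \<delta>0 r"
    define k where "k = (\<lambda>\<tau>. f (x + \<tau> *\<^sub>R z) - \<tau> * (g x \<bullet> z) - \<tau>\<^sup>2 / 2 * (L z \<bullet> z))"
    have le: "norm (\<tau> *\<^sub>R z) \<le> norm z" if "0 \<le> \<tau>" "\<tau> \<le> 1" for \<tau>
      using that by (simp add: mult_left_le_one_le)
    have "\<exists>\<tau>>0. \<tau> < 1 \<and>
        k 1 - k 0 = (1 - 0) * (g (x + \<tau> *\<^sub>R z) \<bullet> z - g x \<bullet> z - \<tau> * (L z \<bullet> z))"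
    proof (rule MVT2)
      fix \<tau> :: real assume \<tau>: "0 \<le> \<tau>" "\<tau> \<le> 1"
      have "x + \<tau> *\<^sub>R z \<in> ball x r"
        using le[OF \<tau>] z by (simp add: dist_norm)
      from DERIV_along_line[OF f[OF this]]
      show "(k has_real_derivative g (x + \<tau> *\<^sub>R z) \<bullet> z - g x \<bullet> z - \<tau> * (L z \<bullet> z)) (at \<tau>)"
        unfolding k_def by (auto intro!: derivative_eq_intros)
    qed simp
    then obtain \<tau> where \<tau>: "0 < \<tau>" "\<tau> < 1"
      "k 1 - k 0 = (g (x + \<tau> *\<^sub>R z) - g x - L (\<tau> *\<^sub>R z)) \<bullet> z"
      by (auto simp: inner_diff_left L.scaleR)
    have "norm (g (x + \<tau> *\<^sub>R z) - g x - L (\<tau> *\<^sub>R z)) \<le> \<eta> * norm (\<tau> *\<^sub>R z)"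
      using le[of \<tau>] \<tau> z by (intro \<delta>0(2)) simp
    also have "\<dots> \<le> \<eta> * norm z" using le[of \<tau>] \<tau> \<eta> by (intro mult_left_mono) auto
    finally have "norm (g (x + \<tau> *\<^sub>R z) - g x - L (\<tau> *\<^sub>R z)) * norm z \<le> \<eta> * norm z * norm z"
      by (rule mult_right_mono) simp
    then have "\<bar>k 1 - k 0\<bar> \<le> \<eta> * (norm z)\<^sup>2"
      unfolding \<tau>(3) using Cauchy_Schwarz_ineq2 order_trans
      by (fastforce simp: power2_eq_square mult.assoc)
    then show "\<bar>f (x + z) - f x - g x \<bullet> z - (L z \<bullet> z) / 2\<bar> \<le> \<eta> * (norm z)\<^sup>2"
      by (simp add: k_def algebra_simps)
  qed (use \<delta>0 r in auto)
qed

section \<open>Symmetry of the second derivative\<close>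

text \<open>The mixed second difference of \<open>f\<close> with steps \<open>s v\<close> and \<open>s w\<close> is
  \<open>s\<^sup>2 (L v \<bullet> w) + o(s\<^sup>2)\<close>, and it is symmetric in \<open>v\<close> and \<open>w\<close>.\<close>

lemma second_difference_bound:
  fixes f :: "'a::real_inner \<Rightarrow> real"
  assumes f: "\<And>y. y \<in> ball x r \<Longrightarrow> (f has_derivative (\<lambda>h. g y \<bullet> h)) (at y)"
    and L: "linear L" and \<eta>: "\<eta> > 0"
    and rem: "\<And>z. norm z < r \<Longrightarrow> norm (g (x + z) - g x - L z) \<le> \<eta> * norm z"
    and s: "s > 0" "s * (norm v + norm w) < r"
  shows "\<bar>f (x + s *\<^sub>R v + s *\<^sub>R w) - f (x + s *\<^sub>R v) - f (x + s *\<^sub>R w) + f x - s\<^sup>2 * (L v \<bullet> w)\<bar>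
    \<le> 2 * \<eta> * s\<^sup>2 * (norm v + norm w)\<^sup>2"
proof -
  interpret linear L by fact
  let ?N = "norm v + norm w"
  \<comment> \<open>\<open>k\<close> compares \<open>f\<close> on two parallel segments in direction
    \<open>w\<close>; \<open>k 1 - k 0\<close> is the mixed second difference, so a single mean
    value theorem reduces it to a difference of gradients.\<close>
  define k where "k = (\<lambda>\<tau>. f ((x + s *\<^sub>R v) + \<tau> *\<^sub>R (s *\<^sub>R w)) - f (x + \<tau> *\<^sub>R (s *\<^sub>R w)))"
  have le: "norm (s *\<^sub>R v + \<tau> *\<^sub>R (s *\<^sub>R w)) \<le> s * ?N" "norm (\<tau> *\<^sub>R (s *\<^sub>R w)) \<le> s * ?N"
    if "0 \<le> \<tau>" "\<tau> \<le> 1" for \<tau>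
  proof -
    have "norm (\<tau> *\<^sub>R (s *\<^sub>R w)) \<le> s * norm w"
      using that s by (simp add: mult_left_le_one_le)
    then show "norm (s *\<^sub>R v + \<tau> *\<^sub>R (s *\<^sub>R w)) \<le> s * ?N"
      using norm_triangle_ineq[of "s *\<^sub>R v" "\<tau> *\<^sub>R (s *\<^sub>R w)"] s by (simp add: algebra_simps)
    show "norm (\<tau> *\<^sub>R (s *\<^sub>R w)) \<le> s * ?N"
      using \<open>norm (\<tau> *\<^sub>R (s *\<^sub>R w)) \<le> s * norm w\<close> s
      by (smt (verit) mult_left_mono norm_ge_zero)
  qed
  have "\<exists>\<tau>>0. \<tau> < 1 \<and> k 1 - k 0 = (1 - 0) *
      (g ((x + s *\<^sub>R v) + \<tau> *\<^sub>R (s *\<^sub>R w)) \<bullet> (s *\<^sub>R w) - g (x + \<tau> *\<^sub>R (s *\<^sub>R w)) \<bullet> (s *\<^sub>R w))"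
  proof (rule MVT2)
    fix \<tau> :: real assume \<tau>: "0 \<le> \<tau>" "\<tau> \<le> 1"
    have 1: "(x + s *\<^sub>R v) + \<tau> *\<^sub>R (s *\<^sub>R w) \<in> ball x r"
      using le(1)[OF \<tau>] s unfolding mem_ball dist_commute[of x] by (simp add: dist_norm add.assoc)
    have 2: "x + \<tau> *\<^sub>R (s *\<^sub>R w) \<in> ball x r"
      using le(2)[OF \<tau>] s by (simp add: dist_norm)
    show "(k has_real_derivative g ((x + s *\<^sub>R v) + \<tau> *\<^sub>R (s *\<^sub>R w)) \<bullet> (s *\<^sub>R w)
        - g (x + \<tau> *\<^sub>R (s *\<^sub>R w)) \<bullet> (s *\<^sub>R w)) (at \<tau>)"
      unfolding k_def
      by (rule DERIV_diff[OF DERIV_along_line[OF f[OF 1]] DERIV_along_line[OF f[OF 2]]])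
  qed simp
  then obtain \<tau> where \<tau>: "0 < \<tau>" "\<tau> < 1" and k0: "k 1 - k 0 = (1 - 0) *
      (g ((x + s *\<^sub>R v) + \<tau> *\<^sub>R (s *\<^sub>R w)) \<bullet> (s *\<^sub>R w) - g (x + \<tau> *\<^sub>R (s *\<^sub>R w)) \<bullet> (s *\<^sub>R w))"
    by blast
  have k: "k 1 - k 0 =
      (g (x + (s *\<^sub>R v + \<tau> *\<^sub>R (s *\<^sub>R w))) - g (x + \<tau> *\<^sub>R (s *\<^sub>R w))) \<bullet> (s *\<^sub>R w)"
    unfolding k0 by (simp only: inner_diff_left add.assoc) simp
  define z1 z2 where "z1 = s *\<^sub>R v + \<tau> *\<^sub>R (s *\<^sub>R w)" and "z2 = \<tau> *\<^sub>R (s *\<^sub>R w)"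
  define R where "R z = g (x + z) - g x - L z" for z
  have z: "norm z1 \<le> s * ?N" "norm z2 \<le> s * ?N" using le[of \<tau>] \<tau> by (auto simp: z1_def z2_def)
  have "norm (R z1) \<le> \<eta> * (s * ?N)" "norm (R z2) \<le> \<eta> * (s * ?N)"
    unfolding R_def
    using order_trans[OF rem[of z1] mult_left_mono[OF z(1), of \<eta>]]
      order_trans[OF rem[of z2] mult_left_mono[OF z(2), of \<eta>]] z s \<eta> by auto
  then have "norm (R z1 - R z2) \<le> 2 * \<eta> * (s * ?N)"
    using norm_triangle_ineq4[of "R z1" "R z2"] by simp
  then have "norm (R z1 - R z2) * norm (s *\<^sub>R w) \<le> 2 * \<eta> * (s * ?N) * (s * ?N)"
    using s \<eta> by (intro mult_mono) auto
  then have "\<bar>(R z1 - R z2) \<bullet> (s *\<^sub>R w)\<bar> \<le> 2 * \<eta> * (s * ?N) * (s * ?N)"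
    using Cauchy_Schwarz_ineq2[of "R z1 - R z2" "s *\<^sub>R w"] by linarith
  moreover have "(R z1 - R z2) \<bullet> (s *\<^sub>R w) = k 1 - k 0 - s\<^sup>2 * (L v \<bullet> w)"
  proof -
    \<comment> \<open>The contributions of \<open>\<tau>\<close> cancel, which is why the unknown
      intermediate point is harmless.\<close>
    have "L z1 - L z2 = s *\<^sub>R L v" by (simp add: z1_def z2_def add scale)
    then have "R z1 - R z2 = g (x + z1) - g (x + z2) - s *\<^sub>R L v"
      by (simp add: R_def algebra_simps)
    moreover have "k 1 - k 0 = (g (x + z1) - g (x + z2)) \<bullet> (s *\<^sub>R w)"
      using k by (simp only: z1_def z2_def)
    ultimately show ?thesis
      by (simp only:) (simp add: inner_diff_left power2_eq_square right_diff_distrib mult.assoc)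
  qed
  ultimately show ?thesis
    by (simp add: k_def power2_eq_square algebra_simps)
qed

text \<open>The mixed second difference does not change when \<open>v\<close> and \<open>w\<close>
  are exchanged, so \<open>s\<^sup>2 * (L v \<bullet> w)\<close> and
  \<open>s\<^sup>2 * (L w \<bullet> v)\<close> approximate the same number; dividing by
  \<open>s\<^sup>2\<close> bounds the difference by a multiple of the arbitrary
  \<open>\<eta>\<close>.\<close>

lemma second_derivative_symmetric:
  fixes f :: "'a::real_inner \<Rightarrow> real"
  assumes r: "r > 0" and f: "\<And>y. y \<in> ball x r \<Longrightarrow> (f has_derivative (\<lambda>h. g y \<bullet> h)) (at y)"
    and g: "(g has_derivative L) (at x)"
  shows "L v \<bullet> w = L w \<bullet> v"
proof -
  have lin: "linear L" using g has_derivative_linear by blast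
  define N where "N = (norm v + norm w)\<^sup>2 + 1"
  have N: "N > 0" by (simp add: N_def add_nonneg_pos)
  have "\<bar>L v \<bullet> w - L w \<bullet> v\<bar> \<le> e" if e: "e > 0" for e
  proof -
    define \<eta> where "\<eta> = e / (4 * N)"
    have \<eta>: "\<eta> > 0" using e N by (simp add: \<eta>_def)
    obtain \<delta> where \<delta>: "\<delta> > 0"
      "\<And>z. norm z < \<delta> \<Longrightarrow> norm (g (x + z) - g x - L z) \<le> \<eta> * norm z"
      using has_derivative_remainder_bound[OF g \<eta>] by blast
    define \<rho> where "\<rho> = min r \<delta>"
    have \<rho>: "\<rho> > 0" using r \<delta> by (simp add: \<rho>_def)
    define s where "s = \<rho> / (2 * (norm v + norm w + 1))"
    have s: "s > 0" using \<rho> by (simp add: s_def add_nonneg_pos)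
    have sr: "s * (norm v + norm w) < \<rho>"
    proof -
      have "s * (norm v + norm w) < s * (2 * (norm v + norm w + 1))"
        using s by (intro mult_strict_left_mono) (auto simp: add_nonneg_pos)
      also have "\<dots> = \<rho>" by (simp add: s_def) (smt (verit) norm_ge_zero)
      finally show ?thesis .
    qed
    have fr: "(f has_derivative (\<lambda>h. g y \<bullet> h)) (at y)" if "y \<in> ball x \<rho>" for y
      using that f by (simp add: \<rho>_def)
    have rem: "norm (g (x + z) - g x - L z) \<le> \<eta> * norm z" if "norm z < \<rho>" for z
      using that \<delta> by (simp add: \<rho>_def)
    have sum: "x + s *\<^sub>R w + s *\<^sub>R v = x + s *\<^sub>R v + s *\<^sub>R w" by simp
    have "\<bar>s\<^sup>2 * (L v \<bullet> w) - s\<^sup>2 * (L w \<bullet> v)\<bar> \<le> 4 * \<eta> * s\<^sup>2 * (norm v + norm w)\<^sup>2"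
      using second_difference_bound[OF fr lin \<eta> rem s sr]
        second_difference_bound[OF fr lin \<eta> rem s sr[unfolded add.commute[of "norm v"]]]
      unfolding sum by (simp add: add.commute[of "norm w"])
    then have "s\<^sup>2 * \<bar>L v \<bullet> w - L w \<bullet> v\<bar> \<le> s\<^sup>2 * (4 * \<eta> * (norm v + norm w)\<^sup>2)"
      unfolding right_diff_distrib[symmetric] abs_mult by (simp add: mult_ac)
    then have "\<bar>L v \<bullet> w - L w \<bullet> v\<bar> \<le> 4 * \<eta> * (norm v + norm w)\<^sup>2"
      using s by simp
    also have "\<dots> \<le> 4 * \<eta> * N" using \<eta> by (simp add: N_def)
    also have "\<dots> = e" using N by (simp add: \<eta>_def)
    finally show ?thesis .
  qed
  then have "\<bar>L v \<bullet> w - L w \<bullet> v\<bar> \<le> 0" by (rule field_le_epsilon[of _ 0, simplified]) auto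
  then show ?thesis by simp
qed

section \<open>Derivatives and parabolic expansion of test functions\<close>

text \<open>\<open>grad\<close> stores only the values of the derivative on the coordinate axes;
  linearity recovers the whole derivative from them. The next lemma does the same for
  \<open>hess\<close>.\<close>

lemma C21_has_derivative_grad:
  fixes \<phi> :: "real^'n \<Rightarrow> real \<Rightarrow> real"
  assumes "C21 \<Omega> t1 t2 \<phi>" "x \<in> \<Omega>" "t \<in> tint t1 t2"
  shows "((\<lambda>y. \<phi> y t) has_derivative (\<lambda>h. grad \<phi> t x \<bullet> h)) (at x)"
proof -
  let ?D = "frechet_derivative (\<lambda>y. \<phi> y t) (at x)"
  have D: "((\<lambda>y. \<phi> y t) has_derivative ?D) (at x)"
    using assms frechet_derivative_works unfolding C21_def by blast
  interpret linear ?D using D by (rule has_derivative_linear)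
  have "?D h = grad \<phi> t x \<bullet> h" for h
  proof -
    have "?D h = ?D (\<Sum>i\<in>UNIV. h $ i *\<^sub>R axis i 1)"
      using basis_expansion[of h] by (simp add: scalar_mult_eq_scaleR)
    also have "\<dots> = grad \<phi> t x \<bullet> h"
      by (simp add: sum scale grad_def inner_vec_def mult.commute)
    finally show ?thesis .
  qed
  then show ?thesis using D has_derivative_eq_rhs by blast
qed

lemma C21_has_derivative_hess:
  fixes \<phi> :: "real^'n \<Rightarrow> real \<Rightarrow> real"
  assumes "C21 \<Omega> t1 t2 \<phi>" "x \<in> \<Omega>" "t \<in> tint t1 t2"
  shows "(grad \<phi> t has_derivative (\<lambda>h. hess \<phi> x t *v h)) (at x)"
proof -
  let ?D = "frechet_derivative (grad \<phi> t) (at x)"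
  have D: "(grad \<phi> t has_derivative ?D) (at x)"
    using assms frechet_derivative_works unfolding C21_def by blast
  interpret linear ?D using D by (rule has_derivative_linear)
  have "frechet_derivative (\<lambda>y. grad \<phi> t y $ i) (at x) = (\<lambda>h. ?D h $ i)" for i
    using frechet_derivative_at[OF bounded_linear.has_derivative[OF bounded_linear_vec_nth D]]
    by simp
  then have H: "hess \<phi> x t $ i $ j = ?D (axis j 1) $ i" for i j
    by (simp add: hess_def)
  have "?D h = hess \<phi> x t *v h" for h
  proof -
    have "?D h = ?D (\<Sum>i\<in>UNIV. h $ i *\<^sub>R axis i 1)"
      using basis_expansion[of h] by (simp add: scalar_mult_eq_scaleR)
    also have "\<dots> = hess \<phi> x t *v h"
      by (simp add: sum scale H vec_eq_iff matrix_vector_mult_def mult.commute)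
    finally show ?thesis .
  qed
  then show ?thesis using D has_derivative_eq_rhs by blast
qed

lemma C21_has_derivative_dt:
  assumes "C21 \<Omega> t1 t2 \<phi>" "x \<in> \<Omega>" "t \<in> tint t1 t2"
  shows "((\<lambda>s. \<phi> x s) has_real_derivative dt \<phi> x t) (at t)"
  using assms unfolding C21_def dt_def
  by (meson DERIV_deriv_iff_real_differentiable)

lemma hess_symmetric:
  fixes \<phi> :: "real^'n \<Rightarrow> real \<Rightarrow> real"
  assumes \<Omega>: "open \<Omega>" and C: "C21 \<Omega> t1 t2 \<phi>" and x: "x \<in> \<Omega>" and t: "t \<in> tint t1 t2"
  shows "transpose (hess \<phi> x t) = hess \<phi> x t"
proof -
  obtain r where r: "r > 0" "ball x r \<subseteq> \<Omega>" using \<Omega> x open_contains_ball by blast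
  have "(hess \<phi> x t *v v) \<bullet> w = (hess \<phi> x t *v w) \<bullet> v" for v w
    by (rule second_derivative_symmetric[OF r(1) C21_has_derivative_grad[OF C _ t]
          C21_has_derivative_hess[OF C x t]]) (use r in auto)
  from this[of "axis _ 1" "axis _ 1"] show ?thesis
    by (simp add: vec_eq_iff transpose_def inner_axis matrix_vector_mult_basis column_def)
qed

text \<open>Expand in space at the fixed time \<open>t\<close>, then go back from \<open>t\<close>
  to \<open>s\<close> at the fixed point \<open>x + z\<close> by the mean value theorem. Joint
  continuity of \<open>dt \<phi>\<close> allows its value there to be replaced by the one at
  \<open>(x, t)\<close>. The expansion looks at times \<open>s \<le> t\<close> because the cylinders
  extend backwards.\<close>

lemma parabolic_taylor:
  fixes \<phi> :: "real^'n \<Rightarrow> real \<Rightarrow> real"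
  assumes \<Omega>: "open \<Omega>" and C: "C21 \<Omega> t1 t2 \<phi>" and x: "x \<in> \<Omega>" and t: "t \<in> tint t1 t2"
    and \<eta>: "\<eta> > 0"
  obtains r where "r > 0" "ball x r \<subseteq> \<Omega>" "{t - r<..t} \<subseteq> tint t1 t2"
    "\<And>z s. norm z < r \<Longrightarrow> t - r < s \<Longrightarrow> s \<le> t \<Longrightarrow>
       \<bar>\<phi> (x + z) s - \<phi> x t - grad \<phi> t x \<bullet> z - (z \<bullet> (hess \<phi> x t *v z)) / 2 - (- dt \<phi> x t) * (t - s)\<bar>
         \<le> \<eta> * ((norm z)\<^sup>2 + (t - s))"
proof -
  obtain r0 where r0: "r0 > 0" "ball x r0 \<subseteq> \<Omega>" using \<Omega> x open_contains_ball by blast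
  obtain r1 where r1: "r1 > 0" "r1 \<le> r0" and tay:
    "\<And>z. norm z < r1 \<Longrightarrow> \<bar>\<phi> (x + z) t - \<phi> x t - grad \<phi> t x \<bullet> z - ((hess \<phi> x t *v z) \<bullet> z) / 2\<bar>
        \<le> \<eta> * (norm z)\<^sup>2"
    by (rule second_order_taylor[OF r0(1) C21_has_derivative_grad[OF C _ t]
          C21_has_derivative_hess[OF C x t] \<eta>]) (use r0 in auto)
  have op: "open (\<Omega> \<times> tint t1 t2)" using \<Omega> by (simp add: tint_def open_Times)
  have "isCont (\<lambda>(x,t). dt \<phi> x t) (x, t)"
    using C x t continuous_on_eq_continuous_at[OF op] unfolding C21_def by auto
  then obtain d where d: "d > 0"
    "\<And>y s. dist (y, s) (x, t) < d \<Longrightarrow> \<bar>dt \<phi> y s - dt \<phi> x t\<bar> < \<eta>"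
    using \<eta> unfolding continuous_at_eps_delta by (force simp: dist_real_def)
  \<comment> \<open>The half of \<open>d\<close> leaves room for the space and the time displacement
    together; \<open>t - t1\<close> keeps the times inside the interval.\<close>
  define r where "r = min (min r1 (d / 2)) (t - t1)"
  have tt: "t1 < t" "t < t2" using t by (auto simp: tint_def)
  show thesis
  proof (rule that)
    show r: "r > 0" using r1 d tt by (simp add: r_def)
    show br: "ball x r \<subseteq> \<Omega>" using r0 r1 by (auto simp: r_def)
    show ts: "{t - r<..t} \<subseteq> tint t1 t2" using tt by (auto simp: r_def tint_def)
    fix z :: "real^'n" and s assume z: "norm z < r" and s: "t - r < s" "s \<le> t"
    have xz: "x + z \<in> \<Omega>" using z br by (auto simp: dist_norm)
    have time: "\<bar>\<phi> (x + z) s - \<phi> (x + z) t - (- dt \<phi> x t) * (t - s)\<bar> \<le> \<eta> * (t - s)"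
    proof (cases "s = t")
      case False
      then have st: "s < t" using s by simp
      have "\<exists>\<sigma>>s. \<sigma> < t \<and> \<phi> (x + z) t - \<phi> (x + z) s = (t - s) * dt \<phi> (x + z) \<sigma>"
        by (rule MVT2[OF st C21_has_derivative_dt[OF C xz]]) (use s ts in auto)
      then obtain \<sigma> where \<sigma>: "s < \<sigma>" "\<sigma> < t"
        and eq: "\<phi> (x + z) t - \<phi> (x + z) s = (t - s) * dt \<phi> (x + z) \<sigma>" by blast
      have "dist (x + z, \<sigma>) (x, t) \<le> dist (x + z) x + dist \<sigma> t"
        unfolding dist_Pair_Pair by (rule sqrt_sum_squares_le_sum) auto
      also have "\<dots> < d" using z s \<sigma> by (auto simp: dist_norm r_def dist_real_def)
      finally have "\<bar>dt \<phi> (x + z) \<sigma> - dt \<phi> x t\<bar> \<le> \<eta>" using d(2) by fastforce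
      then have "(t - s) * \<bar>dt \<phi> (x + z) \<sigma> - dt \<phi> x t\<bar> \<le> (t - s) * \<eta>"
        using st by (intro mult_left_mono) auto
      moreover have "\<phi> (x + z) s - \<phi> (x + z) t - (- dt \<phi> x t) * (t - s)
          = - ((t - s) * (dt \<phi> (x + z) \<sigma> - dt \<phi> x t))"
        using eq by (simp add: algebra_simps)
      ultimately show ?thesis using st by (simp add: abs_mult mult.commute)
    qed simp
    have "norm z < r1" using z by (simp add: r_def)
    from tay[OF this] time
    show "\<bar>\<phi> (x + z) s - \<phi> x t - grad \<phi> t x \<bullet> z - (z \<bullet> (hess \<phi> x t *v z)) / 2
        - (- dt \<phi> x t) * (t - s)\<bar> \<le> \<eta> * ((norm z)\<^sup>2 + (t - s))"
      by (simp add: inner_commute[of z] distrib_left)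
  qed
qed

section \<open>Averages over small cylinders\<close>

lemma has_integral_ball_quadratic:
  fixes g :: "real^'n" and A M :: "real^'n^'n"
  assumes e: "e > 0"
  shows "((\<lambda>y. c + g \<bullet> (A *v y) + y \<bullet> (M *v y)) has_integral
     (c + trace M * e\<^sup>2 / (real CARD('n) + 2)) * measure lborel (ball (0::real^'n) e)) (ball 0 e)"
proof -
  let ?B = "ball (0::real^'n) e"
  have i1: "((\<lambda>y. c) has_integral c * measure lborel ?B) ?B"
    using has_integral_mult_right[OF has_integral_integral[THEN iffD1, OF integrable_on_ball_continuous[of 0 e "\<lambda>_::real^'n. 1"]], of c]
      lmeasure_integral[of ?B] by (simp add: measure_def)
  have i2: "((\<lambda>y. g \<bullet> (A *v y)) has_integral 0) ?B"
    using integrable_integral[OF integrable_on_ball_continuous[of 0 e "\<lambda>y. g \<bullet> (A *v y)"]]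
    by (simp add: integral_ball_linear continuous_intros)
  have i3: "((\<lambda>y. y \<bullet> (M *v y)) has_integral
      trace M * e\<^sup>2 / (real CARD('n) + 2) * measure lborel ?B) ?B"
    using integrable_integral[OF integrable_on_ball_continuous[of 0 e "\<lambda>y. y \<bullet> (M *v y)"]]
    by (simp add: integral_ball_quadratic[OF e] continuous_intros)
  show ?thesis
    using has_integral_add[OF has_integral_add[OF i1 i2] i3] by (simp add: distrib_right)
qed

text \<open>The deviation may grow like a quadratic form \<open>N\<close> and is not just bounded by
  a constant: the average of the form is a multiple of \<open>trace N\<close>, a quantity that can
  later be absorbed by shifting the Hessian.\<close>

lemma ball_average_taylor:
  fixes G :: "real^'n \<Rightarrow> real" and A M N :: "real^'n^'n"
  assumes e: "e > 0" and G: "G integrable_on ball 0 e"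
    and bound: "\<And>y. y \<in> ball 0 e \<Longrightarrow>
      \<bar>G y - c - g \<bullet> (A *v y) - (y \<bullet> (M *v y)) / 2\<bar> \<le> \<kappa> + y \<bullet> (N *v y)"
  shows "\<bar>1 / measure lborel (ball (0::real^'n) e) * integral (ball 0 e) G
      - c - e\<^sup>2 / (2 * (real CARD('n) + 2)) * trace M\<bar>
    \<le> \<kappa> + e\<^sup>2 / (real CARD('n) + 2) * trace N"
proof -
  let ?B = "ball (0::real^'n) e"
  define V where "V = measure lborel ?B"
  have V: "V > 0" using e by (simp add: V_def)
  have half: "y \<bullet> (((1/2) *\<^sub>R M + N) *v y) = (y \<bullet> (M *v y)) / 2 + y \<bullet> (N *v y)"
    "y \<bullet> (((1/2) *\<^sub>R M - N) *v y) = (y \<bullet> (M *v y)) / 2 - y \<bullet> (N *v y)" for y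
    by (simp_all add: matrix_vector_mult_add_rdistrib matrix_vector_mult_diff_rdistrib
        scaleR_matrix_vector_assoc[symmetric] inner_simps)
  have tr: "trace ((1/2) *\<^sub>R M + N) = trace M / 2 + trace N"
    "trace ((1/2) *\<^sub>R M - N) = trace M / 2 - trace N"
    by (simp_all add: trace_def sum.distrib sum_subtractf sum_divide_distrib)
  have up: "integral ?B G \<le> (c + \<kappa> + trace ((1/2) *\<^sub>R M + N) * e\<^sup>2 / (real CARD('n) + 2)) * V"
    unfolding V_def
  proof (rule has_integral_le[OF integrable_integral[OF G] has_integral_ball_quadratic[OF e, where g = g and A = A]])
    fix y assume "y \<in> ?B"
    from bound[OF this] show "G y \<le> c + \<kappa> + g \<bullet> (A *v y) + y \<bullet> (((1/2) *\<^sub>R M + N) *v y)"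
      unfolding half by linarith
  qed
  have lo: "(c - \<kappa> + trace ((1/2) *\<^sub>R M - N) * e\<^sup>2 / (real CARD('n) + 2)) * V \<le> integral ?B G"
    unfolding V_def
  proof (rule has_integral_le[OF has_integral_ball_quadratic[OF e, where g = g and A = A] integrable_integral[OF G]])
    fix y assume "y \<in> ?B"
    from bound[OF this] show "c - \<kappa> + g \<bullet> (A *v y) + y \<bullet> (((1/2) *\<^sub>R M - N) *v y) \<le> G y"
      unfolding half by linarith
  qed
  define a where "a = e\<^sup>2 / (real CARD('n) + 2)"
  have a: "e\<^sup>2 / (2 * (real CARD('n) + 2)) = a / 2" by (simp add: a_def)
  have "1 / V * integral ?B G \<le> c + \<kappa> + (trace M / 2 + trace N) * a"
    using up V unfolding tr a_def by (simp add: divide_le_eq)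
  moreover have "c - \<kappa> + (trace M / 2 - trace N) * a \<le> 1 / V * integral ?B G"
    using lo V unfolding tr a_def by (simp add: le_divide_eq)
  ultimately show ?thesis
    unfolding V_def[symmetric] a a_def[symmetric] by (simp add: abs_le_iff algebra_simps)
qed

lemma interval_average_taylor:
  fixes K :: "real \<Rightarrow> real"
  assumes h: "h > 0" and K: "K integrable_on {t - h..t}"
    and bound: "\<And>s. s \<in> {t - h..t} \<Longrightarrow> \<bar>K s - c - p * (t - s)\<bar> \<le> d + \<eta> * (t - s)"
  shows "\<bar>1 / h * integral {t - h..t} K - c - p * h / 2\<bar> \<le> d + \<eta> * h / 2"
proof -
  have lin: "((\<lambda>s. a + q * (t - s)) has_integral (a + q * h / 2) * h) {t - h..t}" for a q :: real
  proof -
    have "((\<lambda>s. a + q * (t - s)) has_integral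
        (a * t - q * (t - t)\<^sup>2 / 2) - (a * (t - h) - q * (t - (t - h))\<^sup>2 / 2)) {t - h..t}"
      by (rule fundamental_theorem_of_calculus)
         (use h in \<open>auto intro!: derivative_eq_intros
            simp: has_real_derivative_iff_has_vector_derivative[symmetric] field_simps\<close>)
    then show ?thesis by (simp add: algebra_simps power2_eq_square)
  qed
  have "integral {t - h..t} K \<le> ((c + d) + (p + \<eta>) * h / 2) * h"
    by (rule has_integral_le[OF integrable_integral[OF K] lin])
       (use bound in \<open>force simp: algebra_simps\<close>)
  moreover have "((c - d) + (p - \<eta>) * h / 2) * h \<le> integral {t - h..t} K"
    by (rule has_integral_le[OF lin integrable_integral[OF K]])
       (use bound in \<open>force simp: algebra_simps\<close>)
  ultimately have "1 / h * integral {t - h..t} K \<le> (c + d) + (p + \<eta>) * h / 2"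
    "(c - d) + (p - \<eta>) * h / 2 \<le> 1 / h * integral {t - h..t} K"
    using h by (simp_all add: divide_le_eq le_divide_eq)
  then show ?thesis by (simp add: algebra_simps add_divide_distrib diff_divide_distrib)
qed

lemma parab_convex_midpoint:
  assumes pc: "parab_convex \<Omega> t1 t2 \<phi>" and s: "s \<in> tint t1 t2"
    and ball: "ball x r \<subseteq> \<Omega>" and z: "norm z < r"
  shows "2 * \<phi> x s \<le> \<phi> (x + z) s + \<phi> (x - z) s"
proof -
  have "closed_segment (x + z) (x - z) \<subseteq> ball x r"
    using z by (intro closed_segment_subset) (auto simp: dist_norm)
  then have "convex_on (closed_segment (x + z) (x - z)) (\<lambda>z. \<phi> z s)"
    using pc ball s unfolding parab_convex_def by blast
  from convex_onD[OF this, of "1/2" "x + z" "x - z"]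
  have "\<phi> ((1/2) *\<^sub>R (x + z) + (1/2) *\<^sub>R (x - z)) s \<le> 1/2 * \<phi> (x + z) s + 1/2 * \<phi> (x - z) s"
    by simp
  moreover have "(1/2) *\<^sub>R (x + z) + (1/2) *\<^sub>R (x - z) = x"
    by (simp add: scaleR_right_distrib scaleR_right_diff_distrib scaleR_left_distrib[symmetric])
  ultimately show ?thesis by simp
qed

text \<open>\<open>M\<close> plays the part of \<open>\<psi> \<epsilon>\<close>. The bound
  \<open>M * \<epsilon> < r\<close> keeps the ellipsoid of points \<open>x + A *v y\<close> inside
  the ball of radius \<open>r\<close>; together with \<open>M * \<epsilon> < 1\<close> it bounds the
  height by \<open>h \<le> (M * \<epsilon>)\<^sup>2 \<le> M * \<epsilon> < r\<close>.\<close>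

locale small_cylinder =
  fixes \<Omega> :: "(real^'n) set" and t1 t2 :: real and \<phi> :: "real^'n \<Rightarrow> real \<Rightarrow> real"
    and x :: "real^'n" and t r M :: real and A :: "real^'n^'n" and b \<epsilon> :: real
  assumes pc: "parab_convex \<Omega> t1 t2 \<phi>"
    and ball: "ball x r \<subseteq> \<Omega>" and time: "{t - r<..t} \<subseteq> tint t1 t2"
    and adm: "admissible M A b" and \<epsilon>: "\<epsilon> > 0" and small: "M * \<epsilon> < r" "M * \<epsilon> < 1"
begin

definition "h = b\<^sup>2 / (real CARD('n) + 2) * \<epsilon>\<^sup>2"

definition "K s = 1 / measure lborel (ball (0::real^'n) \<epsilon>) *
  integral (ball (0::real^'n) \<epsilon>) (\<lambda>y. \<phi> (x + A *v y) s)"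

lemma cyl_avg_eq: "cyl_avg \<phi> x t A b \<epsilon> = 1 / h * integral {t - h..t} K"
  by (simp add: cyl_avg_def h_def K_def[abs_def] Let_def)

lemma b: "b > 0" "b \<le> M" and M: "M > 0"
  using adm by (auto simp: admissible_def)

lemma A_sym: "transpose A = A"
  using adm by (simp add: admissible_def)

lemma vol_pos: "measure lborel (ball (0::real^'n) \<epsilon>) > 0"
  using \<epsilon> by simp

lemma h: "h > 0" "h < r"
proof -
  show "h > 0" using b \<epsilon> by (simp add: h_def)
  have M\<epsilon>: "M * \<epsilon> > 0" using M \<epsilon> by simp
  have "h \<le> b\<^sup>2 * \<epsilon>\<^sup>2"
    by (simp add: h_def divide_le_eq mult_le_cancel_left1 not_less)
  also have "\<dots> = (b * \<epsilon>)\<^sup>2" by (simp add: power_mult_distrib)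
  also have "\<dots> \<le> (M * \<epsilon>)\<^sup>2" using b \<epsilon> by (intro power_mono mult_right_mono) auto
  also have "\<dots> \<le> M * \<epsilon>" using M\<epsilon> small by (simp add: power2_eq_square mult_left_le_one_le)
  finally show "h < r" using small by simp
qed

lemma norm_A_lt:
  assumes "norm y \<le> \<epsilon>"
  shows "norm (A *v y) < r"
proof -
  have "v \<bullet> (A *v v) \<le> M * (v \<bullet> v)" for v
  proof -
    have "v \<bullet> ((M *\<^sub>R mat 1 - A) *v v) \<ge> 0" using adm by (simp add: admissible_def)
    moreover have "(M *\<^sub>R mat 1 - A) *v v = M *\<^sub>R v - A *v v"
      by (simp add: matrix_vector_mult_diff_rdistrib scaleR_matrix_vector_assoc[symmetric])
    ultimately show ?thesis by (simp add: inner_diff_right)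
  qed
  then have "norm (A *v y) \<le> M * norm y"
    using adm M by (intro norm_pd_matrix_vector_le) (auto simp: admissible_def)
  also have "\<dots> \<le> M * \<epsilon>" using assms M by simp
  finally show ?thesis using small by simp
qed

lemma in_domain: "norm y \<le> \<epsilon> \<Longrightarrow> x + A *v y \<in> \<Omega>" "norm y \<le> \<epsilon> \<Longrightarrow> x - A *v y \<in> \<Omega>"
  using norm_A_lt[of y] ball by (auto simp: dist_norm subset_iff)

lemma time_domain: "s \<in> {t - h..t} \<Longrightarrow> s \<in> tint t1 t2"
  using h time by (auto simp: subset_iff)

lemma continuous_slice:
  assumes "s \<in> tint t1 t2"
  shows "continuous_on (cball 0 \<epsilon>) (\<lambda>y. \<phi> (x + A *v y) s)"
proof -
  have "continuous_on (\<Omega> \<times> tint t1 t2) (\<lambda>(x,t). \<phi> x t)" using pc by (simp add: parab_convex_def)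
  moreover have "continuous_on (cball 0 \<epsilon>) (\<lambda>y. (x + A *v y, s))"
    by (intro continuous_intros)
  ultimately have "continuous_on (cball 0 \<epsilon>) ((\<lambda>(x,t). \<phi> x t) \<circ> (\<lambda>y. (x + A *v y, s)))"
    using assms in_domain
    by (intro continuous_on_compose) (auto elim!: continuous_on_subset)
  then show ?thesis by (simp add: o_def)
qed

lemma integrable_slice:
  "s \<in> tint t1 t2 \<Longrightarrow> (\<lambda>y. \<phi> (x + A *v y) s) integrable_on ball 0 \<epsilon>"
  by (intro integrable_on_ball_continuous continuous_slice)

lemma antimono_time: "y \<in> \<Omega> \<Longrightarrow> s \<in> tint t1 t2 \<Longrightarrow> s' \<in> tint t1 t2 \<Longrightarrow> s \<le> s' \<Longrightarrow> \<phi> y s' \<le> \<phi> y s"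
  using pc by (auto simp: parab_convex_def tint_def)

text \<open>\<open>K\<close> is non-increasing in time because \<open>\<phi>\<close> is, and
  monotone functions are integrable on a compact interval.\<close>

lemma K_integrable: "K integrable_on {t - h..t}"
proof -
  have "mono_on {t - h..t} (\<lambda>s. - K s)"
  proof (rule mono_onI)
    fix s s' assume s: "s \<in> {t - h..t}" "s' \<in> {t - h..t}" "s \<le> s'"
    have "integral (ball 0 \<epsilon>) (\<lambda>y. \<phi> (x + A *v y) s') \<le> integral (ball 0 \<epsilon>) (\<lambda>y. \<phi> (x + A *v y) s)"
      using s time_domain in_domain by (intro integral_le integrable_slice antimono_time) auto
    then show "- K s \<le> - K s'"
      using vol_pos by (simp add: K_def divide_right_mono)
  qed
  then have "(\<lambda>s. - (- K s)) integrable_on {t - h..t}"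
    by (intro integrable_neg integrable_on_mono_on)
  then show ?thesis by simp
qed

lemma midpoint_convex:
  assumes "s \<in> tint t1 t2" "norm y \<le> \<epsilon>"
  shows "2 * \<phi> x s \<le> \<phi> (x + A *v y) s + \<phi> (x - A *v y) s"
  by (rule parab_convex_midpoint[OF pc assms(1) ball norm_A_lt[OF assms(2)]])

text \<open>Pair \<open>y\<close> with \<open>- y\<close>: the midpoint inequality is integrated
  over the ball, and the point reflection leaves the integral unchanged.\<close>

lemma K_ge:
  assumes s: "s \<in> tint t1 t2"
  shows "\<phi> x s \<le> K s"
proof -
  let ?G = "\<lambda>y. \<phi> (x + A *v y) s"
  have neg: "signed_perm (\<lambda>_. -1) id y = - y" for y :: "real^'n"
    by (simp add: signed_perm_def vec_eq_iff)
  have refl: "integral (ball 0 \<epsilon>) (\<lambda>y. ?G (- y)) = integral (ball 0 \<epsilon>) ?G"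
    using integral_ball_signed_perm[OF _ _ continuous_slice[OF s], of "\<lambda>_. -1" id]
    by (simp add: neg)
  have cm: "continuous_on (cball 0 \<epsilon>) (\<lambda>y. ?G (- y))"
    by (rule continuous_on_compose2[OF continuous_slice[OF s]]) (auto intro: continuous_intros)
  have "((\<lambda>y. 2 * \<phi> x s + 0 \<bullet> ((0::real^'n^'n) *v y) + y \<bullet> ((0::real^'n^'n) *v y)) has_integral
      (2 * \<phi> x s + trace (0::real^'n^'n) * \<epsilon>\<^sup>2 / (real CARD('n) + 2)) * measure lborel (ball (0::real^'n) \<epsilon>))
      (ball 0 \<epsilon>)"
    by (rule has_integral_ball_quadratic[OF \<epsilon>])
  then have c: "((\<lambda>y. 2 * \<phi> x s) has_integral 2 * \<phi> x s * measure lborel (ball (0::real^'n) \<epsilon>))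
      (ball (0::real^'n) \<epsilon>)"
    by (simp add: trace_def)
  have "2 * \<phi> x s * measure lborel (ball (0::real^'n) \<epsilon>)
      \<le> integral (ball 0 \<epsilon>) ?G + integral (ball 0 \<epsilon>) (\<lambda>y. ?G (- y))"
  proof (rule has_integral_le[OF c has_integral_add[OF integrable_integral integrable_integral]])
    show "?G integrable_on ball 0 \<epsilon>" by (rule integrable_slice[OF s])
    show "(\<lambda>y. ?G (- y)) integrable_on ball 0 \<epsilon>" by (rule integrable_on_ball_continuous[OF cm])
    fix y :: "real^'n" assume "y \<in> ball 0 \<epsilon>"
    then show "2 * \<phi> x s \<le> ?G y + ?G (- y)"
      using midpoint_convex[OF s, of y] by (simp add: vec.neg)
  qed
  then show ?thesis
    using vol_pos unfolding refl by (simp add: K_def le_divide_eq)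
qed

text \<open>An estimate without error term: convexity handles space, monotonicity handles time. It
  settles the degenerate case \<open>p * det H = 0\<close> and bounds the set of averages from
  below.\<close>

lemma cyl_avg_ge: "\<phi> x t \<le> cyl_avg \<phi> x t A b \<epsilon>"
proof -
  have x: "x \<in> \<Omega>" using ball h by (auto simp: subset_iff)
  have tt: "t \<in> tint t1 t2" using time_domain[of t] h by simp
  have "((\<lambda>_. \<phi> x t) has_integral h * \<phi> x t) {t - h..t}"
    using has_integral_const_real[of "\<phi> x t" "t - h" t] h by simp
  then have "h * \<phi> x t \<le> integral {t - h..t} K"
  proof (rule has_integral_le[OF _ integrable_integral[OF K_integrable]])
    fix s assume s: "s \<in> {t - h..t}"
    have "\<phi> x t \<le> \<phi> x s" using s x tt time_domain by (intro antimono_time) auto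
    also have "\<dots> \<le> K s" using s time_domain by (intro K_ge)
    finally show "\<phi> x t \<le> K s" .
  qed
  then show ?thesis using h by (simp add: cyl_avg_eq le_divide_eq mult.commute)
qed

text \<open>Substituting \<open>z = A *v y\<close> turns \<open>H\<close> into
  \<open>A ** H ** A\<close> and the error into the form of \<open>A ** A\<close>. The height
  \<open>h\<close> is normalised by \<open>n + 2\<close> so that \<open>p * h / 2\<close> carries
  the same factor as the spatial term. In the error, the ball contributes
  \<open>2 * trace (A ** A)\<close> and the time interval \<open>b\<^sup>2\<close>.\<close>

lemma cyl_avg_taylor:
  assumes tay: "\<And>z s. norm z < r \<Longrightarrow> t - r < s \<Longrightarrow> s \<le> t \<Longrightarrow>
       \<bar>\<phi> (x + z) s - \<phi> x t - g \<bullet> z - (z \<bullet> (H *v z)) / 2 - p * (t - s)\<bar>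
         \<le> \<eta> * ((norm z)\<^sup>2 + (t - s))"
  shows "\<bar>cyl_avg \<phi> x t A b \<epsilon> - \<phi> x t
      - \<epsilon>\<^sup>2 / (2 * (real CARD('n) + 2)) * (trace (A ** H ** A) + p * b\<^sup>2)\<bar>
    \<le> \<epsilon>\<^sup>2 / (2 * (real CARD('n) + 2)) * (\<eta> * (2 * trace (A ** A) + b\<^sup>2))"
proof -
  let ?n = "real CARD('n)"
  have quad: "(A *v y) \<bullet> (H *v (A *v y)) = y \<bullet> ((A ** H ** A) *v y)" for y
    by (simp add: symmetric_matrix_inner[OF A_sym] matrix_vector_mul_assoc[symmetric])
  have sq: "\<eta> * (norm (A *v y))\<^sup>2 = y \<bullet> ((\<eta> *\<^sub>R (A ** A)) *v y)" for y
    by (simp add: dot_square_norm[symmetric] symmetric_matrix_inner[OF A_sym]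
        scaleR_matrix_vector_assoc[symmetric] matrix_vector_mul_assoc[symmetric])
  have "\<bar>K s - (\<phi> x t + \<epsilon>\<^sup>2 / (2 * (?n + 2)) * trace (A ** H ** A)) - p * (t - s)\<bar>
      \<le> \<epsilon>\<^sup>2 / (?n + 2) * (\<eta> * trace (A ** A)) + \<eta> * (t - s)" if s: "s \<in> {t - h..t}" for s
  proof -
    have "\<bar>K s - (\<phi> x t + p * (t - s)) - \<epsilon>\<^sup>2 / (2 * (?n + 2)) * trace (A ** H ** A)\<bar>
      \<le> \<eta> * (t - s) + \<epsilon>\<^sup>2 / (?n + 2) * trace (\<eta> *\<^sub>R (A ** A))"
      unfolding K_def
    proof (rule ball_average_taylor[OF \<epsilon> integrable_slice[OF time_domain[OF s]]])
      fix y :: "real^'n" assume "y \<in> ball 0 \<epsilon>"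
      then have "norm (A *v y) < r" by (intro norm_A_lt) simp
      from tay[OF this, of s] s h
      show "\<bar>\<phi> (x + A *v y) s - (\<phi> x t + p * (t - s)) - g \<bullet> (A *v y) - (y \<bullet> ((A ** H ** A) *v y)) / 2\<bar>
          \<le> \<eta> * (t - s) + y \<bullet> ((\<eta> *\<^sub>R (A ** A)) *v y)"
        unfolding quad sq[symmetric] by (simp add: algebra_simps)
    qed
    moreover have "trace (\<eta> *\<^sub>R (A ** A)) = \<eta> * trace (A ** A)"
      by (simp add: trace_def sum_distrib_left)
    ultimately show ?thesis by (simp add: algebra_simps)
  qed
  from interval_average_taylor[OF h(1) K_integrable this]
  have "\<bar>cyl_avg \<phi> x t A b \<epsilon> - (\<phi> x t + \<epsilon>\<^sup>2 / (2 * (?n + 2)) * trace (A ** H ** A)) - p * h / 2\<bar>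
      \<le> \<epsilon>\<^sup>2 / (?n + 2) * (\<eta> * trace (A ** A)) + \<eta> * h / 2"
    unfolding cyl_avg_eq .
  moreover have "p * h / 2 = \<epsilon>\<^sup>2 / (2 * (?n + 2)) * (p * b\<^sup>2)"
    by (simp add: h_def mult.commute mult.left_commute)
  moreover have "\<epsilon>\<^sup>2 / (?n + 2) * (\<eta> * trace (A ** A)) + \<eta> * h / 2
      = \<epsilon>\<^sup>2 / (2 * (?n + 2)) * (\<eta> * (2 * trace (A ** A) + b\<^sup>2))"
  proof -
    define m where "m = ?n + 2"
    have "m \<noteq> 0" by (simp add: m_def)
    then show ?thesis unfolding h_def m_def[symmetric] by (simp add: field_simps)
  qed
  ultimately show ?thesis
    by (simp only: distrib_left diff_diff_eq)
qed

end

section \<open>The asymptotic expansion for test functions\<close>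

text \<open>Add the expansions at \<open>s *\<^sub>R v\<close> and \<open>- (s *\<^sub>R v)\<close>:
  the gradient cancels, and midpoint convexity makes the quadratic part nonnegative up to the
  arbitrary \<open>\<eta>\<close>.\<close>

lemma psd_hess:
  fixes \<phi> :: "real^'n \<Rightarrow> real \<Rightarrow> real"
  assumes \<Omega>: "open \<Omega>" and C: "C21 \<Omega> t1 t2 \<phi>" and pc: "parab_convex \<Omega> t1 t2 \<phi>"
    and x: "x \<in> \<Omega>" and t: "t \<in> tint t1 t2"
  shows "psd (hess \<phi> x t)"
  unfolding psd_def
proof (intro conjI allI)
  show "transpose (hess \<phi> x t) = hess \<phi> x t" by (rule hess_symmetric[OF \<Omega> C x t])
  fix v :: "real^'n"
  have "0 \<le> v \<bullet> (hess \<phi> x t *v v) + e" if e: "e > 0" for e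
  proof -
    define N where "N = (norm v)\<^sup>2 + 1"
    have N: "N > 0" by (simp add: N_def add_nonneg_pos)
    define \<eta> where "\<eta> = e / (2 * N)"
    have \<eta>: "\<eta> > 0" using e N by (simp add: \<eta>_def)
    obtain r where r: "r > 0" "ball x r \<subseteq> \<Omega>" and tay: "\<And>z s. norm z < r \<Longrightarrow> t - r < s \<Longrightarrow> s \<le> t \<Longrightarrow>
       \<bar>\<phi> (x + z) s - \<phi> x t - grad \<phi> t x \<bullet> z - (z \<bullet> (hess \<phi> x t *v z)) / 2 - (- dt \<phi> x t) * (t - s)\<bar>
         \<le> \<eta> * ((norm z)\<^sup>2 + (t - s))"
      using parabolic_taylor[OF \<Omega> C x t \<eta>] by metis
    define s where "s = r / (norm v + 1)"
    have s: "s > 0" using r by (simp add: s_def add_nonneg_pos)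
    have "norm (s *\<^sub>R v) = r * (norm v / (norm v + 1))" using s r by (simp add: s_def)
    also have "\<dots> < r * 1" using r by (intro mult_strict_left_mono) (auto simp: divide_less_eq add_nonneg_pos)
    finally have sv: "norm (s *\<^sub>R v) < r" by simp
    have "(s *\<^sub>R v) \<bullet> (hess \<phi> x t *v (s *\<^sub>R v)) + 2 * \<eta> * (norm (s *\<^sub>R v))\<^sup>2 \<ge> 0"
      using parab_convex_midpoint[OF pc t r(2) sv] tay[OF sv, of t] tay[of "- (s *\<^sub>R v)" t] sv r
      by (simp add: vec.neg)
    then have "s\<^sup>2 * (v \<bullet> (hess \<phi> x t *v v) + 2 * \<eta> * (norm v)\<^sup>2) \<ge> 0"
      by (simp add: matrix_vector_mult_scaleR power_mult_distrib power2_eq_square algebra_simps)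
    then have "0 \<le> v \<bullet> (hess \<phi> x t *v v) + 2 * \<eta> * (norm v)\<^sup>2"
      using s by (simp add: zero_le_mult_iff)
    also have "2 * \<eta> * (norm v)\<^sup>2 \<le> 2 * \<eta> * N" using \<eta> by (simp add: N_def)
    also have "\<dots> = e" using N by (simp add: \<eta>_def)
    finally show ?thesis by simp
  qed
  then show "0 \<le> v \<bullet> (hess \<phi> x t *v v)" by (rule field_le_epsilon)
qed

lemma dt_nonpos:
  fixes \<phi> :: "real^'n \<Rightarrow> real \<Rightarrow> real"
  assumes \<Omega>: "open \<Omega>" and C: "C21 \<Omega> t1 t2 \<phi>" and pc: "parab_convex \<Omega> t1 t2 \<phi>"
    and x: "x \<in> \<Omega>" and t: "t \<in> tint t1 t2"
  shows "- dt \<phi> x t \<ge> 0"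
proof (rule field_le_epsilon)
  fix \<eta> :: real assume \<eta>: "\<eta> > 0"
  obtain r where r: "r > 0" "{t - r<..t} \<subseteq> tint t1 t2"
    and tay: "\<And>z s. norm z < r \<Longrightarrow> t - r < s \<Longrightarrow> s \<le> t \<Longrightarrow>
       \<bar>\<phi> (x + z) s - \<phi> x t - grad \<phi> t x \<bullet> z - (z \<bullet> (hess \<phi> x t *v z)) / 2 - (- dt \<phi> x t) * (t - s)\<bar>
         \<le> \<eta> * ((norm z)\<^sup>2 + (t - s))"
    using parabolic_taylor[OF \<Omega> C x t \<eta>] by metis
  define s where "s = t - r / 2"
  have s: "s \<in> tint t1 t2" "s \<le> t" "t - s > 0" "t - r < s" using r by (auto simp: s_def)
  then have "\<phi> x t \<le> \<phi> x s" using pc x t by (auto simp: parab_convex_def tint_def)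
  with tay[of 0 s] r s have "0 \<le> (- dt \<phi> x t + \<eta>) * (t - s)"
    by (simp add: algebra_simps)
  then show "0 \<le> - dt \<phi> x t + \<eta>" using s by (simp add: zero_le_mult_iff)
qed

section \<open>Admissible pairs and perturbation of the optimisation problem\<close>

text \<open>Since \<open>\<psi> \<epsilon>\<close> tends to infinity, any fixed pair is eventually
  admissible; the operator norm of \<open>A\<close> is a sufficient bound for its quadratic
  form.\<close>

lemma admissible_if_large:
  fixes A :: "real^'n^'n"
  assumes "transpose A = A" "\<And>v. v \<noteq> 0 \<Longrightarrow> v \<bullet> (A *v v) > 0" "b > 0" "b * det A = 1"
  obtains M where "\<And>M'. M' \<ge> M \<Longrightarrow> admissible M' A b"
proof (rule that)
  let ?C = "onorm ((*v) A)"
  fix M' assume M': "M' \<ge> max b ?C"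
  have "v \<bullet> ((M' *\<^sub>R mat 1 - A) *v v) \<ge> 0" for v
  proof -
    have "v \<bullet> (A *v v) \<le> norm v * norm (A *v v)" by (rule norm_cauchy_schwarz)
    also have "\<dots> \<le> norm v * (?C * norm v)"
      by (intro mult_left_mono onorm) (auto simp: matrix_vector_mul_bounded_linear)
    also have "\<dots> \<le> norm v * (M' * norm v)"
      using M' by (intro mult_left_mono mult_right_mono) auto
    also have "\<dots> = M' * (v \<bullet> v)" by (simp add: dot_square_norm power2_eq_square)
    finally show ?thesis
      by (simp add: matrix_vector_mult_diff_rdistrib scaleR_matrix_vector_assoc[symmetric] inner_diff_right)
  qed
  then show "admissible M' A b" using assms M' by (simp add: admissible_def)
qed

lemma admissible_mat_1: "M \<ge> 1 \<Longrightarrow> admissible M (mat 1 :: real^'n^'n) 1"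
  using mult_right_mono[of 1 M "v \<bullet> v" for v :: "real^'n"]
  by (simp add: admissible_def matrix_vector_mult_diff_rdistrib transpose_mat
      scaleR_matrix_vector_assoc[symmetric] inner_diff_right)

lemma trace_square_nonneg:
  fixes A :: "real^'n^'n"
  assumes "transpose A = A"
  shows "trace (A ** A) \<ge> 0"
proof -
  have "A $ i $ j = A $ j $ i" for i j
    using arg_cong[OF assms, of "\<lambda>M. M $ j $ i"] by (simp add: transpose_def)
  then have "trace (A ** A) = (\<Sum>i\<in>UNIV. \<Sum>j\<in>UNIV. A $ i $ j * A $ i $ j)"
    by (simp add: trace_def matrix_matrix_mult_def)
  then show ?thesis by (simp add: sum_nonneg)
qed

text \<open>An error \<open>\<eta> * trace (A ** A)\<close> is exactly the effect of adding a
  multiple of the identity to \<open>H\<close>; this is how errors that are not uniform in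
  \<open>A\<close> are absorbed.\<close>

lemma trace_conj_shift:
  fixes A H :: "real^'n^'n"
  shows "trace (A ** (H + \<eta> *\<^sub>R mat 1) ** A) = trace (A ** H ** A) + \<eta> * trace (A ** A)"
proof -
  have "A ** (A ** (H + \<eta> *\<^sub>R mat 1)) = A ** (A ** H) + \<eta> *\<^sub>R (A ** A)"
    by (simp add: matrix_add_ldistrib matrix_scalar_ac scalar_matrix_assoc[symmetric])
  then have "trace (A ** (A ** (H + \<eta> *\<^sub>R mat 1))) = trace (A ** (A ** H)) + \<eta> * trace (A ** A)"
    by (simp only: trace_add) (simp add: trace_def sum_distrib_left)
  then show ?thesis by (simp only: trace_mul_sym[of "A ** _" A])
qed

lemma inner_shift: "v \<bullet> ((H + \<eta> *\<^sub>R mat 1) *v v) = v \<bullet> (H *v v) + \<eta> * (v \<bullet> v)"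
  for H :: "real^'n^'n"
  by (simp add: matrix_vector_mult_add_rdistrib scaleR_matrix_vector_assoc[symmetric] inner_add_right)

lemma transpose_shift:
  fixes H :: "real^'n^'n"
  assumes "transpose H = H"
  shows "transpose (H + \<eta> *\<^sub>R mat 1) = H + \<eta> *\<^sub>R mat 1"
  using assms by (auto simp: vec_eq_iff transpose_def mat_def)

text \<open>One statement for two perturbations: \<open>c = 1\<close> makes a semidefinite problem
  definite, \<open>c = -2\<close> absorbs the Taylor error.\<close>

lemma tendsto_det_shift:
  fixes H :: "real^'n^'n"
  shows "((\<lambda>\<eta>. (p + c * \<eta>) * det (H + (c * \<eta>) *\<^sub>R mat 1)) \<longlongrightarrow> p * det H) (at_right 0)"
proof -
  have "((\<lambda>\<eta>. H + (c * \<eta>) *\<^sub>R mat 1) \<longlongrightarrow> H + (c * 0) *\<^sub>R mat 1) (at_right 0)"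
    by (intro tendsto_intros)
  then have "((\<lambda>\<eta>. H + (c * \<eta>) *\<^sub>R mat 1) \<longlongrightarrow> H) (at_right 0)" by simp
  then have "((\<lambda>\<eta>. det (H + (c * \<eta>) *\<^sub>R mat 1)) \<longlongrightarrow> det H) (at_right 0)"
    unfolding det_def by (intro tendsto_intros tendsto_vec_nth)
  moreover have "((\<lambda>\<eta>. p + c * \<eta>) \<longlongrightarrow> p + c * 0) (at_right 0)" by (intro tendsto_intros)
  ultimately show ?thesis using tendsto_mult by force
qed

text \<open>The infimum \<open>W\<close> need not be attained when \<open>p * det H = 0\<close>, hence the perturbation.\<close>

lemma near_optimal_matrix:
  fixes H :: "real^'n^'n"
  assumes H: "psd H" and p: "p \<ge> 0" and \<delta>: "\<delta> > 0"
    and W: "W = (real CARD('n) + 1) * (p * det H) powr (1 / (real CARD('n) + 1))"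
  obtains A b where "transpose A = A" "\<And>v. v \<noteq> 0 \<Longrightarrow> v \<bullet> (A *v v) > 0" "b > 0" "b * det A = 1"
    "trace (A ** H ** A) + p * b\<^sup>2 \<le> W + \<delta>"
proof -
  let ?a = "1 / (real CARD('n) + 1)"
  let ?F = "\<lambda>\<eta>. (p + 1 * \<eta>) * det (H + (1 * \<eta>) *\<^sub>R mat 1)"
  have psd: "psd (H + \<eta> *\<^sub>R mat 1)" if "\<eta> > 0" for \<eta>
    using H that by (auto simp: psd_def inner_shift transpose_shift)
  \<comment> \<open>When \<open>p * det H = 0\<close> the base of the power tends to 0, and passing
    to the limit there needs the base to be nonnegative.\<close>
  have "\<forall>\<^sub>F \<eta> in at_right 0. ?F \<eta> \<ge> 0"
    using p by (auto simp: eventually_at_right_field intro!: exI[of _ 1] mult_nonneg_nonneg det_psd_nonneg psd)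
  then have "((\<lambda>\<eta>. ?F \<eta> powr ?a) \<longlongrightarrow> (p * det H) powr ?a) (at_right 0)"
    by (intro tendsto_powr' tendsto_det_shift tendsto_const) auto
  then have "((\<lambda>\<eta>. (real CARD('n) + 1) * ?F \<eta> powr ?a) \<longlongrightarrow> W) (at_right 0)"
    unfolding W by (intro tendsto_mult tendsto_const)
  from order_tendstoD(2)[OF this, of "W + \<delta>"] \<delta>
  have "\<forall>\<^sub>F \<eta> in at_right 0. (real CARD('n) + 1) * ?F \<eta> powr ?a < W + \<delta> \<and> \<eta> > 0"
    by (simp add: eventually_conj_iff eventually_at_right_less)
  then obtain \<eta> where \<eta>: "\<eta> > 0" and less: "(real CARD('n) + 1) * ?F \<eta> powr ?a < W + \<delta>"
    using eventually_happens'[OF trivial_limit_at_right_real] by blast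
  have pd: "v \<bullet> ((H + \<eta> *\<^sub>R mat 1) *v v) > 0" if "v \<noteq> 0" for v
    using H \<eta> that by (auto simp: psd_def inner_shift intro!: add_nonneg_pos)
  obtain A b where A: "transpose A = A" "\<And>v. v \<noteq> 0 \<Longrightarrow> v \<bullet> (A *v v) > 0" "b > 0" "b * det A = 1"
    and eq: "trace (A ** (H + \<eta> *\<^sub>R mat 1) ** A) + (p + \<eta>) * b\<^sup>2
       = (real CARD('n) + 1) * ((p + \<eta>) * det (H + \<eta> *\<^sub>R mat 1)) powr ?a"
    using trace_plus_eq_det[OF transpose_shift pd, of "p + \<eta>"] H p \<eta> unfolding psd_def by auto
  \<comment> \<open>The pair is optimal for the shifted data; removing the shift can only decrease
    the value.\<close>
  have "\<eta> * trace (A ** A) \<ge> 0" "\<eta> * b\<^sup>2 \<ge> 0"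
    using \<eta> trace_square_nonneg[OF A(1)] by auto
  with less eq have "trace (A ** H ** A) + p * b\<^sup>2 \<le> W + \<delta>"
    by (simp add: trace_conj_shift distrib_right)
  with A show thesis using that by blast
qed

text \<open>The functional minus the error is at least the functional of \<open>H\<close> lowered by
  \<open>2 * \<eta>\<close> times the identity and \<open>p - 2 * \<eta>\<close>, to which the
  determinant bound applies. For small \<open>\<eta>\<close> the lowered data stay semidefinite and
  nonnegative, because \<open>H\<close> is bounded below by a positive multiple of the identity and
  \<open>p\<close> is positive.\<close>

lemma perturbed_lower_bound:
  fixes H :: "real^'n^'n"
  assumes H: "psd H" and p: "p \<ge> 0" and pH: "p * det H > 0" and \<delta>: "\<delta> > 0"
    and W: "W = (real CARD('n) + 1) * (p * det H) powr (1 / (real CARD('n) + 1))"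
  obtains \<eta> where "\<eta> > 0" "\<And>A b. transpose A = A \<Longrightarrow> b * det A = 1 \<Longrightarrow>
    trace (A ** H ** A) + p * b\<^sup>2 - \<eta> * (2 * trace (A ** A) + b\<^sup>2) \<ge> W - \<delta>"
proof -
  let ?a = "1 / (real CARD('n) + 1)"
  let ?F = "\<lambda>\<eta>. (p + (-2) * \<eta>) * det (H + ((-2) * \<eta>) *\<^sub>R mat 1)"
  have ppos: "p > 0" and dpos: "det H > 0"
    using p det_psd_nonneg[OF H] pH by (auto simp: zero_less_mult_iff)
  obtain m where m: "m > 0" "\<And>v. v \<bullet> (H *v v) \<ge> m * (v \<bullet> v)"
    using psd_pos_det_imp_pd[OF H dpos] by blast
  have "((\<lambda>\<eta>. ?F \<eta> powr ?a) \<longlongrightarrow> (p * det H) powr ?a) (at_right 0)"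
    using pH by (intro tendsto_powr' tendsto_det_shift tendsto_const) auto
  then have "((\<lambda>\<eta>. (real CARD('n) + 1) * ?F \<eta> powr ?a) \<longlongrightarrow> W) (at_right 0)"
    unfolding W by (intro tendsto_mult tendsto_const)
  from order_tendstoD(1)[OF this, of "W - \<delta>"] \<delta>
  have "\<forall>\<^sub>F \<eta> in at_right 0. (real CARD('n) + 1) * ?F \<eta> powr ?a > W - \<delta>" by simp
  moreover have "\<forall>\<^sub>F \<eta> in at_right 0. \<eta> > 0 \<and> 2 * \<eta> < p \<and> 2 * \<eta> < m"
    using ppos m(1) by (auto simp: eventually_at_right_field intro!: exI[of _ "min p m / 2"])
  ultimately have "\<forall>\<^sub>F \<eta> in at_right 0. (real CARD('n) + 1) * ?F \<eta> powr ?a > W - \<delta>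
      \<and> \<eta> > 0 \<and> 2 * \<eta> < p \<and> 2 * \<eta> < m"
    by (rule eventually_conj)
  then obtain \<eta> where \<eta>: "\<eta> > 0" "2 * \<eta> < p" "2 * \<eta> < m"
    and less: "(real CARD('n) + 1) * ?F \<eta> powr ?a > W - \<delta>"
    using eventually_happens'[OF trivial_limit_at_right_real] by blast
  have psd: "psd (H + (-2 * \<eta>) *\<^sub>R mat 1)"
    unfolding psd_def
  proof (intro conjI allI)
    show "transpose (H + (-2 * \<eta>) *\<^sub>R mat 1) = H + (-2 * \<eta>) *\<^sub>R mat 1"
      by (rule transpose_shift) (use H in \<open>simp add: psd_def\<close>)
    fix v :: "real^'n"
    have "2 * \<eta> * (v \<bullet> v) \<le> m * (v \<bullet> v)" using \<eta> by (intro mult_right_mono) auto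
    with m(2)[of v] show "0 \<le> v \<bullet> ((H + (-2 * \<eta>) *\<^sub>R mat 1) *v v)"
      unfolding inner_shift by simp
  qed
  show thesis
  proof (rule that[OF \<eta>(1)])
    fix A :: "real^'n^'n" and b :: real assume A: "transpose A = A" "b * det A = 1"
    have "W - \<delta> < trace (A ** (H + (-2 * \<eta>) *\<^sub>R mat 1) ** A) + (p - 2 * \<eta>) * b\<^sup>2"
      using trace_plus_ge_det[OF psd _ A, of "p - 2 * \<eta>"] less \<eta> by simp
    \<comment> \<open>The error takes only \<open>\<eta> * b\<^sup>2\<close> from the time term, so
      lowering \<open>p\<close> by \<open>2 * \<eta>\<close> is more than enough and allows the same
      shift for \<open>H\<close> and \<open>p\<close>.\<close>
    also have "\<dots> \<le> trace (A ** H ** A) + p * b\<^sup>2 - \<eta> * (2 * trace (A ** A) + b\<^sup>2)"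
      unfolding trace_conj_shift using \<eta> by (simp add: algebra_simps)
    finally show "trace (A ** H ** A) + p * b\<^sup>2 - \<eta> * (2 * trace (A ** A) + b\<^sup>2) \<ge> W - \<delta>" by simp
  qed
qed

text \<open>Once the quotient has a limit, the one-sided little-o condition just reads off its sign,
  since taking positive parts is continuous and commutes with dividing by
  \<open>\<epsilon>\<^sup>2\<close>.\<close>

lemma tendsto_pos_part_zero_iff:
  assumes "((\<lambda>\<epsilon>. g \<epsilon> / \<epsilon>\<^sup>2) \<longlongrightarrow> l) (at_right (0::real))"
  shows "((\<lambda>\<epsilon>. max (g \<epsilon>) 0 / \<epsilon>\<^sup>2) \<longlongrightarrow> (0::real)) (at_right 0) \<longleftrightarrow> l \<le> 0"
proof -
  have "((\<lambda>\<epsilon>. max (g \<epsilon> / \<epsilon>\<^sup>2) 0) \<longlongrightarrow> max l 0) (at_right 0)"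
    by (intro tendsto_max assms tendsto_const)
  moreover have "max (g \<epsilon> / \<epsilon>\<^sup>2) 0 = max (g \<epsilon>) 0 / \<epsilon>\<^sup>2" for \<epsilon>
    by (simp add: max_def zero_le_divide_iff divide_le_0_iff)
  ultimately have lim: "((\<lambda>\<epsilon>. max (g \<epsilon>) 0 / \<epsilon>\<^sup>2) \<longlongrightarrow> max l 0) (at_right 0)" by simp
  show ?thesis
  proof
    assume "((\<lambda>\<epsilon>. max (g \<epsilon>) 0 / \<epsilon>\<^sup>2) \<longlongrightarrow> (0::real)) (at_right 0)"
    from tendsto_unique[OF trivial_limit_at_right_real this lim] show "l \<le> 0" by simp
  next
    assume "l \<le> 0"
    then show "((\<lambda>\<epsilon>. max (g \<epsilon>) 0 / \<epsilon>\<^sup>2) \<longlongrightarrow> (0::real)) (at_right 0)"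
      using lim by (simp add: max_absorb2)
  qed
qed

lemma powr_le_powr_iff:
  assumes "a > 0" "u \<ge> 0" "v \<ge> (0::real)"
  shows "u powr a \<le> v powr a \<longleftrightarrow> u \<le> v"
  using assms powr_mono2[of a u v] powr_less_mono2[of a v u] by linarith

section \<open>Expansion of the infimum at a fixed point and test function\<close>

locale test_function =
  fixes \<Omega> :: "(real^'n) set" and t1 t2 :: real and \<phi> :: "real^'n \<Rightarrow> real \<Rightarrow> real"
    and x :: "real^'n" and t :: real and \<psi> :: "real \<Rightarrow> real"
  assumes \<Omega>: "open \<Omega>" and pc: "parab_convex \<Omega> t1 t2 \<phi>" and C: "C21 \<Omega> t1 t2 \<phi>"
    and x: "x \<in> \<Omega>" and t: "t \<in> tint t1 t2"
    and \<psi>: "filterlim \<psi> at_top (at_right 0)" "((\<lambda>\<epsilon>. \<epsilon> * \<psi> \<epsilon>) \<longlongrightarrow> 0) (at_right 0)"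
begin

definition "H = hess \<phi> x t"
definition "p = - dt \<phi> x t"
definition "W = (real CARD('n) + 1) * (p * det H) powr (1 / (real CARD('n) + 1))"
definition "avgs \<epsilon> = {cyl_avg \<phi> x t A b \<epsilon> | (A::real^'n^'n) b. admissible (\<psi> \<epsilon>) A b}"

lemma H: "psd H" and p: "p \<ge> 0"
  unfolding H_def p_def by (rule psd_hess[OF \<Omega> C pc x t] dt_nonpos[OF \<Omega> C pc x t])+

text \<open>Both limits of \<open>\<psi>\<close> enter: divergence gives
  \<open>\<psi> \<epsilon> \<ge> M0\<close>, and the decay of
  \<open>\<epsilon> * \<psi> \<epsilon>\<close> fits all admissible cylinders into the radius
  \<open>r\<close> simultaneously.\<close>

lemma eventually_small_cylinder:
  assumes r: "r > 0" "ball x r \<subseteq> \<Omega>" "{t - r<..t} \<subseteq> tint t1 t2"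
  shows "\<forall>\<^sub>F \<epsilon> in at_right 0. \<epsilon> > 0 \<and> \<psi> \<epsilon> \<ge> M0 \<and>
    (\<forall>A b. admissible (\<psi> \<epsilon>) A b \<longrightarrow> small_cylinder \<Omega> t1 t2 \<phi> x t r (\<psi> \<epsilon>) A b \<epsilon>)"
proof -
  have "\<forall>\<^sub>F \<epsilon> in at_right 0. \<psi> \<epsilon> \<ge> M0"
    using \<psi>(1) by (simp add: filterlim_at_top)
  moreover have "\<forall>\<^sub>F \<epsilon> in at_right 0. \<epsilon> * \<psi> \<epsilon> < min r 1"
    using order_tendstoD(2)[OF \<psi>(2), of "min r 1"] r by simp
  moreover have "\<forall>\<^sub>F \<epsilon> in at_right 0. (\<epsilon>::real) > 0"
    by (rule eventually_at_right_less)
  ultimately show ?thesis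
    by eventually_elim (use pc r in \<open>auto simp: small_cylinder_def mult.commute\<close>)
qed

lemma taylor:
  assumes "\<eta> > 0"
  obtains r where "r > 0" "ball x r \<subseteq> \<Omega>" "{t - r<..t} \<subseteq> tint t1 t2"
    "\<And>z s. norm z < r \<Longrightarrow> t - r < s \<Longrightarrow> s \<le> t \<Longrightarrow>
       \<bar>\<phi> (x + z) s - \<phi> x t - grad \<phi> t x \<bullet> z - (z \<bullet> (H *v z)) / 2 - p * (t - s)\<bar>
         \<le> \<eta> * ((norm z)\<^sup>2 + (t - s))"
  unfolding H_def p_def using parabolic_taylor[OF \<Omega> C x t assms] by blast

text \<open>In the main case \<open>\<eta>\<close> is fixed first, from \<open>H\<close>,
  \<open>p\<close> and \<open>\<delta>\<close>, and determines \<open>r\<close>; only then does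
  \<open>\<epsilon>\<close> become small. The bound therefore holds for all admissible pairs at once
  and passes to the infimum.\<close>

lemma eventually_Inf_ge:
  assumes \<delta>: "\<delta> > 0"
  shows "\<forall>\<^sub>F \<epsilon> in at_right 0.
    \<phi> x t + \<epsilon>\<^sup>2 / (2 * (real CARD('n) + 2)) * (W - \<delta>) \<le> Inf (avgs \<epsilon>)"
proof -
  have ne: "avgs \<epsilon> \<noteq> {}" if "\<psi> \<epsilon> \<ge> 1" for \<epsilon>
    using admissible_mat_1[OF that] unfolding avgs_def by blast
  show ?thesis
  proof (cases "p * det H > 0")
    case True
    obtain \<eta> where \<eta>: "\<eta> > 0" "\<And>A b. transpose A = A \<Longrightarrow> b * det A = 1 \<Longrightarrow>
        trace (A ** H ** A) + p * b\<^sup>2 - \<eta> * (2 * trace (A ** A) + b\<^sup>2) \<ge> W - \<delta>"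
      using perturbed_lower_bound[OF H p True \<delta> W_def] by blast
    obtain r where r: "r > 0" "ball x r \<subseteq> \<Omega>" "{t - r<..t} \<subseteq> tint t1 t2"
      and tay: "\<And>z s. norm z < r \<Longrightarrow> t - r < s \<Longrightarrow> s \<le> t \<Longrightarrow>
       \<bar>\<phi> (x + z) s - \<phi> x t - grad \<phi> t x \<bullet> z - (z \<bullet> (H *v z)) / 2 - p * (t - s)\<bar>
         \<le> \<eta> * ((norm z)\<^sup>2 + (t - s))"
      using taylor[OF \<eta>(1)] by blast
    show ?thesis
      using eventually_small_cylinder[OF r, of 1]
    proof eventually_elim
      case (elim \<epsilon>)
      show ?case
      proof (rule cInf_greatest)
        show "avgs \<epsilon> \<noteq> {}" using ne elim by blast
        fix a assume "a \<in> avgs \<epsilon>"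
        then obtain A :: "real^'n^'n" and b where a: "a = cyl_avg \<phi> x t A b \<epsilon>"
          and adm: "admissible (\<psi> \<epsilon>) A b"
          by (auto simp: avgs_def)
        let ?k = "\<epsilon>\<^sup>2 / (2 * (real CARD('n) + 2))"
        have W: "?k * (W - \<delta>) \<le> ?k * (trace (A ** H ** A) + p * b\<^sup>2 - \<eta> * (2 * trace (A ** A) + b\<^sup>2))"
          using adm by (intro mult_left_mono \<eta>(2)) (auto simp: admissible_def)
        have "small_cylinder \<Omega> t1 t2 \<phi> x t r (\<psi> \<epsilon>) A b \<epsilon>" using elim adm by blast
        then have "\<bar>cyl_avg \<phi> x t A b \<epsilon> - \<phi> x t - ?k * (trace (A ** H ** A) + p * b\<^sup>2)\<bar>
            \<le> ?k * (\<eta> * (2 * trace (A ** A) + b\<^sup>2))"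
          by (rule small_cylinder.cyl_avg_taylor[where g = "grad \<phi> t x"]) (rule tay)
        then have "?k * (trace (A ** H ** A) + p * b\<^sup>2) - ?k * (\<eta> * (2 * trace (A ** A) + b\<^sup>2)) \<le> a - \<phi> x t"
          unfolding a by linarith
        with W show "\<phi> x t + ?k * (W - \<delta>) \<le> a"
          unfolding right_diff_distrib[of ?k "trace _ + _"] by linarith
      qed
    qed
  next
    case False
    \<comment> \<open>Both factors are nonnegative, so their product is 0 and \<open>W\<close> is a
      multiple of a power of 0; the lower bound \<open>\<phi> x t\<close> of the averages then
      suffices.\<close>
    then have W0: "W = 0"
      using p det_psd_nonneg[OF H] by (simp add: W_def zero_less_mult_iff not_less antisym)
    obtain r where r: "r > 0" "ball x r \<subseteq> \<Omega>" "{t - r<..t} \<subseteq> tint t1 t2"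
      by (rule taylor[OF zero_less_one], rule that)
    show ?thesis
      using eventually_small_cylinder[OF r, of 1]
    proof eventually_elim
      case (elim \<epsilon>)
      show ?case
      proof (rule cInf_greatest)
        show "avgs \<epsilon> \<noteq> {}" using ne elim by blast
        fix a assume "a \<in> avgs \<epsilon>"
        then have "\<phi> x t \<le> a" using elim by (auto simp: avgs_def intro: small_cylinder.cyl_avg_ge)
        moreover have "\<epsilon>\<^sup>2 / (2 * (real CARD('n) + 2)) * (W - \<delta>) \<le> 0"
          using \<delta> by (simp add: W0)
        ultimately show "\<phi> x t + \<epsilon>\<^sup>2 / (2 * (real CARD('n) + 2)) * (W - \<delta>) \<le> a" by simp
      qed
    qed
  qed
qed

text \<open>For an upper bound one pair is enough. It is chosen near optimal and independent of
  \<open>\<epsilon>\<close>, so its Taylor error is at most a fixed multiple of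
  \<open>\<eta> * \<epsilon>\<^sup>2\<close>.\<close>

lemma eventually_Inf_le:
  assumes \<delta>: "\<delta> > 0"
  shows "\<forall>\<^sub>F \<epsilon> in at_right 0.
    Inf (avgs \<epsilon>) \<le> \<phi> x t + \<epsilon>\<^sup>2 / (2 * (real CARD('n) + 2)) * (W + \<delta>)"
proof -
  have "\<delta> / 2 > 0" using \<delta> by simp
  then obtain A :: "real^'n^'n" and b
    where A: "transpose A = A" "\<And>v. v \<noteq> 0 \<Longrightarrow> v \<bullet> (A *v v) > 0" "b > 0" "b * det A = 1"
      and opt: "trace (A ** H ** A) + p * b\<^sup>2 \<le> W + \<delta> / 2"
    using near_optimal_matrix[OF H p _ W_def] by blast
  obtain M where M: "\<And>M'. M' \<ge> M \<Longrightarrow> admissible M' A b"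
    using admissible_if_large[OF A] by blast
  define S where "S = 2 * trace (A ** A) + b\<^sup>2"
  have S: "S > 0" using trace_square_nonneg[OF A(1)] A(3) by (simp add: S_def add_nonneg_pos)
  \<comment> \<open>Near optimality uses up one half of \<open>\<delta>\<close>; this
    \<open>\<eta>\<close> makes the Taylor error the other half.\<close>
  define \<eta> where "\<eta> = \<delta> / (2 * S)"
  have \<eta>: "\<eta> > 0" using \<delta> S by (simp add: \<eta>_def)
  have \<eta>S: "\<eta> * S = \<delta> / 2" using S by (simp add: \<eta>_def)
  obtain r where r: "r > 0" "ball x r \<subseteq> \<Omega>" "{t - r<..t} \<subseteq> tint t1 t2"
    and tay: "\<And>z s. norm z < r \<Longrightarrow> t - r < s \<Longrightarrow> s \<le> t \<Longrightarrow>
     \<bar>\<phi> (x + z) s - \<phi> x t - grad \<phi> t x \<bullet> z - (z \<bullet> (H *v z)) / 2 - p * (t - s)\<bar>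
       \<le> \<eta> * ((norm z)\<^sup>2 + (t - s))"
    using taylor[OF \<eta>] by blast
  show ?thesis
    using eventually_small_cylinder[OF r, of M]
  proof eventually_elim
    case (elim \<epsilon>)
    let ?k = "\<epsilon>\<^sup>2 / (2 * (real CARD('n) + 2))"
    have adm: "admissible (\<psi> \<epsilon>) A b" using M elim by blast
    \<comment> \<open>On the reals \<open>Inf\<close> is known to be a lower bound only for sets
      bounded below; \<open>cyl_avg_ge\<close> supplies the bound.\<close>
    have "bdd_below (avgs \<epsilon>)"
      using elim by (auto simp: avgs_def intro!: bdd_belowI[of _ "\<phi> x t"] small_cylinder.cyl_avg_ge)
    then have "Inf (avgs \<epsilon>) \<le> cyl_avg \<phi> x t A b \<epsilon>"
      using adm by (intro cInf_lower) (auto simp: avgs_def)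
    also have "\<dots> \<le> \<phi> x t + ?k * (trace (A ** H ** A) + p * b\<^sup>2) + ?k * (\<eta> * S)"
    proof -
      have "small_cylinder \<Omega> t1 t2 \<phi> x t r (\<psi> \<epsilon>) A b \<epsilon>" using elim adm by blast
      then have "\<bar>cyl_avg \<phi> x t A b \<epsilon> - \<phi> x t - ?k * (trace (A ** H ** A) + p * b\<^sup>2)\<bar>
            \<le> ?k * (\<eta> * (2 * trace (A ** A) + b\<^sup>2))"
        by (rule small_cylinder.cyl_avg_taylor[where g = "grad \<phi> t x"]) (rule tay)
      then show ?thesis unfolding S_def by linarith
    qed
    also have "\<dots> \<le> \<phi> x t + ?k * (W + \<delta> / 2) + ?k * (\<delta> / 2)"
      unfolding \<eta>S using mult_left_mono[OF opt, of ?k] by simp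
    also have "\<dots> = \<phi> x t + ?k * (W + \<delta>)"
      unfolding add.assoc distrib_left[symmetric] by simp
    finally show ?case .
  qed
qed

theorem Inf_expansion:
  "((\<lambda>\<epsilon>. (Inf (avgs \<epsilon>) - \<phi> x t) / \<epsilon>\<^sup>2) \<longlongrightarrow> W / (2 * (real CARD('n) + 2))) (at_right 0)"
proof (rule tendstoI)
  fix e :: real assume e: "e > 0"
  define c where "c = 2 * (real CARD('n) + 2)"
  have c: "c > 0" by (simp add: c_def)
  define \<delta> where "\<delta> = c * e / 2"
  have \<delta>: "\<delta> > 0" using e c by (simp add: \<delta>_def)
  have \<delta>c: "\<delta> / c = e / 2" using c by (simp add: \<delta>_def)
  have "\<forall>\<^sub>F \<epsilon> in at_right 0. (\<epsilon>::real) > 0" by (rule eventually_at_right_less)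
  with eventually_Inf_ge[OF \<delta>] eventually_Inf_le[OF \<delta>]
  show "\<forall>\<^sub>F \<epsilon> in at_right 0. dist ((Inf (avgs \<epsilon>) - \<phi> x t) / \<epsilon>\<^sup>2) (W / (2 * (real CARD('n) + 2))) < e"
    unfolding c_def[symmetric]
  proof eventually_elim
    case (elim \<epsilon>)
    have \<epsilon>2: "\<epsilon>\<^sup>2 > 0" using elim by simp
    have "\<epsilon>\<^sup>2 / c * (W - \<delta>) = (W / c - e / 2) * \<epsilon>\<^sup>2"
      unfolding \<delta>c[symmetric] diff_divide_distrib[symmetric] by simp
    moreover have "\<epsilon>\<^sup>2 / c * (W + \<delta>) = (W / c + e / 2) * \<epsilon>\<^sup>2"
      unfolding \<delta>c[symmetric] add_divide_distrib[symmetric] by simp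
    ultimately have "(W / c - e / 2) * \<epsilon>\<^sup>2 \<le> Inf (avgs \<epsilon>) - \<phi> x t"
      "Inf (avgs \<epsilon>) - \<phi> x t \<le> (W / c + e / 2) * \<epsilon>\<^sup>2"
      using elim by linarith+
    then have "W / c - e / 2 \<le> (Inf (avgs \<epsilon>) - \<phi> x t) / \<epsilon>\<^sup>2"
      "(Inf (avgs \<epsilon>) - \<phi> x t) / \<epsilon>\<^sup>2 \<le> W / c + e / 2"
      using \<epsilon>2 by (simp_all only: le_divide_eq divide_le_eq if_True)
    then show ?case unfolding dist_real_def using e by (simp only: abs_less_iff) linarith
  qed
qed

lemma Meps_limit:
  "((\<lambda>\<epsilon>. (Meps \<psi> f \<epsilon> \<phi> x t - \<phi> x t) / \<epsilon>\<^sup>2) \<longlongrightarrow>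
     (real CARD('n) + 1) / (2 * (real CARD('n) + 2)) *
       ((p * det H) powr (1 / (real CARD('n) + 1)) - f x t powr (1 / (real CARD('n) + 1))))
     (at_right 0)"
proof -
  let ?c = "(real CARD('n) + 1) / (2 * (real CARD('n) + 2))" and ?a = "1 / (real CARD('n) + 1)"
  have "((\<lambda>\<epsilon>. (Inf (avgs \<epsilon>) - \<phi> x t) / \<epsilon>\<^sup>2 - ?c * f x t powr ?a) \<longlongrightarrow>
      W / (2 * (real CARD('n) + 2)) - ?c * f x t powr ?a) (at_right 0)"
    by (intro tendsto_diff Inf_expansion tendsto_const)
  moreover have "\<forall>\<^sub>F \<epsilon> in at_right 0. (Inf (avgs \<epsilon>) - \<phi> x t) / \<epsilon>\<^sup>2 - ?c * f x t powr ?a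
      = (Meps \<psi> f \<epsilon> \<phi> x t - \<phi> x t) / \<epsilon>\<^sup>2"
    using eventually_at_right_less[of "0::real"]
  proof eventually_elim
    case (elim \<epsilon>)
    have "Meps \<psi> f \<epsilon> \<phi> x t - \<phi> x t = (Inf (avgs \<epsilon>) - \<phi> x t) - (?c * f x t powr ?a) * \<epsilon>\<^sup>2"
      unfolding Meps_def avgs_def by simp
    then show ?case using elim by (simp only: diff_divide_distrib) simp
  qed
  moreover have "W / (2 * (real CARD('n) + 2)) - ?c * f x t powr ?a
      = ?c * ((p * det H) powr ?a - f x t powr ?a)"
    unfolding W_def by (simp only: right_diff_distrib times_divide_eq_left)
  ultimately show ?thesis by (simp only:) (rule Lim_transform_eventually)
qed

text \<open>The sign of the limit decides each condition, and roots of order \<open>n + 1\<close> of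
  the nonnegative numbers \<open>p * det H\<close> and \<open>f x t\<close> compare like the numbers
  themselves.\<close>

lemma mean_value_inequalities_iff:
  assumes f: "f x t \<ge> 0"
  shows "((\<lambda>\<epsilon>. max (Meps \<psi> f \<epsilon> \<phi> x t - \<phi> x t) 0 / \<epsilon>\<^sup>2) \<longlongrightarrow> 0) (at_right 0)
      \<longleftrightarrow> - dt \<phi> x t * det (hess \<phi> x t) \<le> f x t" (is ?le)
    and "((\<lambda>\<epsilon>. max (\<phi> x t - Meps \<psi> f \<epsilon> \<phi> x t) 0 / \<epsilon>\<^sup>2) \<longlongrightarrow> 0) (at_right 0)
      \<longleftrightarrow> - dt \<phi> x t * det (hess \<phi> x t) \<ge> f x t" (is ?ge)
proof -
  let ?c = "(real CARD('n) + 1) / (2 * (real CARD('n) + 2))" and ?a = "1 / (real CARD('n) + 1)"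
  have c: "?c > 0" and a: "?a > 0" by simp_all
  have pH: "p * det H \<ge> 0" using p det_psd_nonneg[OF H] by simp
  have flip: "(\<phi> x t - Meps \<psi> f \<epsilon> \<phi> x t) / \<epsilon>\<^sup>2 = - ((Meps \<psi> f \<epsilon> \<phi> x t - \<phi> x t) / \<epsilon>\<^sup>2)" for \<epsilon>
    by (simp add: minus_divide_left)
  note lim = Meps_limit[of f]
  have pos: "k * y \<le> 0 \<longleftrightarrow> y \<le> 0" if "k > 0" for k y :: real
    using that by (simp add: mult_le_0_iff)
  show ?le
    unfolding tendsto_pos_part_zero_iff[OF lim] pos[OF c]
    using powr_le_powr_iff[OF a pH f] by (simp add: p_def H_def)
  have "((\<lambda>\<epsilon>. (\<phi> x t - Meps \<psi> f \<epsilon> \<phi> x t) / \<epsilon>\<^sup>2) \<longlongrightarrow>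
      - (?c * ((p * det H) powr ?a - f x t powr ?a))) (at_right 0)"
    unfolding flip by (rule tendsto_minus[OF lim])
  from tendsto_pos_part_zero_iff[OF this[unfolded mult_minus_right[symmetric]]] show ?ge
    unfolding pos[OF c] using powr_le_powr_iff[OF a f pH] by (simp add: p_def H_def)
qed

end

theorem theorem2p5:
  fixes \<Omega> :: "(real^'n) set" and t1 t2 :: real
    and f u :: "real^'n \<Rightarrow> real \<Rightarrow> real" and \<psi> :: "real \<Rightarrow> real"
  assumes "open \<Omega>" and "t1 < t2"
    and "continuous_on (\<Omega> \<times> {t1<..<t2}) (\<lambda>(x,t). f x t)"
    and "\<forall>x\<in>\<Omega>. \<forall>t\<in>{t1<..<t2}. f x t \<ge> 0"
    and "\<forall>\<epsilon>>0. \<psi> \<epsilon> > 0"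
    and "filterlim \<psi> at_top (at_right 0)"
    and "((\<lambda>\<epsilon>. \<epsilon> * \<psi> \<epsilon>) \<longlongrightarrow> 0) (at_right 0)"
    and "parab_convex \<Omega> t1 t2 u"
  shows "visc_sol \<Omega> t1 t2 f u \<longleftrightarrow> amvp_visc \<Omega> t1 t2 \<psi> f u"
proof -
  have iff: "((\<lambda>\<epsilon>. max (Meps \<psi> f \<epsilon> \<phi> x t - \<phi> x t) 0 / \<epsilon>\<^sup>2) \<longlongrightarrow> 0) (at_right 0)
      \<longleftrightarrow> - dt \<phi> x t * det (hess \<phi> x t) \<le> f x t"
    "((\<lambda>\<epsilon>. max (\<phi> x t - Meps \<psi> f \<epsilon> \<phi> x t) 0 / \<epsilon>\<^sup>2) \<longlongrightarrow> 0) (at_right 0)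
      \<longleftrightarrow> - dt \<phi> x t * det (hess \<phi> x t) \<ge> f x t"
    if "x \<in> \<Omega>" "t \<in> tint t1 t2" "parab_convex \<Omega> t1 t2 \<phi>" "C21 \<Omega> t1 t2 \<phi>" for x t \<phi>
  proof -
    interpret test_function \<Omega> t1 t2 \<phi> x t \<psi>
      using assms that by unfold_locales auto
    have "f x t \<ge> 0" using assms(4) that by (simp add: tint_def)
    from mean_value_inequalities_iff[of f, OF this]
    show "((\<lambda>\<epsilon>. max (Meps \<psi> f \<epsilon> \<phi> x t - \<phi> x t) 0 / \<epsilon>\<^sup>2) \<longlongrightarrow> 0) (at_right 0)
      \<longleftrightarrow> - dt \<phi> x t * det (hess \<phi> x t) \<le> f x t"
    "((\<lambda>\<epsilon>. max (\<phi> x t - Meps \<psi> f \<epsilon> \<phi> x t) 0 / \<epsilon>\<^sup>2) \<longlongrightarrow> 0) (at_right 0)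
      \<longleftrightarrow> - dt \<phi> x t * det (hess \<phi> x t) \<ge> f x t"
      by blast+
  qed
  \<comment> \<open>Both definitions quantify over the same test functions, and by
    \<open>iff\<close> each kind of contact is tied to the same inequality in both.\<close>
  show ?thesis
    unfolding visc_sol_def amvp_visc_def using assms(8) iff by meson
qed

end
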